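(* Let $B_1\subseteq\mathbb{R}^{n+1}$ be the unit ball with boundary the unit sphere $\mathbb{S}^n$, where $n=2k+1$ for some integer $k\geq 1$. For $\lambda>0$ let $\hat g^\lambda$ be the homogeneous metric on $\mathbb{S}^n\cong\mathrm{SU}(k+1)/\mathrm{SU}(k)$ which at a point has the standard diagonal form $\hat g^\lambda=\sigma_1^2+\lambda(\sigma_2^2+\cdots+\sigma_n^2)$. Then, as $\lambda$ varies continuously from $\lambda=1$ on the interval $(\frac{1}{n+1},1]$ (resp. on $[1,n+1)$), one of the following holds: (a) for each $\lambda\in(\frac{1}{n+1},1]$ (resp. $\lambda\in[1,n+1)$) there exists a non-positively curved conformally compact Einstein metric on $B_1$ with conformal infinity $(\mathbb{S}^n,[\hat g^\lambda])$; or (b) there exists $\lambda_1\in(\frac{1}{n+1},1]$ (resp. $\lambda_1\in[1,n+1)$) such that for each $\lambda\in[\lambda_1,1]$ (resp. $\lambda\in[1,\lambda_1]$) there exists a non-positively curved conformally compact Einstein metric $g^\lambda$ on $B_1$ with conformal infinity $(\mathbb{S}^n,[\hat g^\lambda])$, there exists $p\in B_1$ such that the sectional curvature of $g^{\lambda_1}$ at $p$ vanishes in some direction, and moreover for any small $\epsilon>0$ there exists $\lambda_2\in(\lambda_1-\epsilon,\lambda_1)$ (resp. $\lambda_2\in(\lambda_1,\lambda_1+\epsilon)$) and a conformally compact Einstein metric $g^{\lambda_2}$ on $B_1$ with conformal infinity $(\mathbb{S}^n,[\hat g^{\lambda_2}])$ whose sectional curvature is positive in some direction at some point of $B_1$.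
   Context: $\sigma_1,\dots,\sigma_n$ are the $1$-forms dual to a basis of $\mathfrak p$ in the $\mathrm{Ad}_{\mathrm{SU}(k)}$-invariant splitting $\mathfrak{su}(k+1)=\mathfrak{su}(k)\oplus\mathfrak p$, where $\mathfrak p=\mathfrak p_0\oplus\mathfrak p_1$ with $\mathfrak p_0$ one-dimensional with trivial $\mathrm{SU}(k)$-action (dual to $\sigma_1$) and $\mathfrak p_1$ the irreducible complement (dual to $\sigma_2,\dots,\sigma_n$); normalized so that $\hat g^1$ is the round metric. A complete metric $g$ on $B_1$ is conformally compact if for some defining function $x$ ($x>0$ in $B_1$, $x=0$ and $dx\ne0$ on $\mathbb{S}^n$) $x^2g$ extends continuously to $\overline{B_1}$; its conformal infinity is the conformal class of $x^2g|_{\mathbb{S}^n}$; it is conformally compact Einstein if in addition $\mathrm{Ric}_g=-ng$. *)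

theory Defs
  imports "HOL-Analysis.Analysis"
begin

text \<open>Riemannian geometry in global coordinates on the open unit ball B_1 of R^(n+1),
  modelled as real^'m with CARD('m) = n+1. A metric is a matrix field g.\<close>

type_synonym 'm mfield = "real^'m \<Rightarrow> real^'m^'m"

fun Ck_on :: "nat \<Rightarrow> ('a::euclidean_space \<Rightarrow> 'b::real_normed_vector) \<Rightarrow> 'a set \<Rightarrow> bool" where
  "Ck_on 0 f S = continuous_on S f"
| "Ck_on (Suc k) f S = ((\<forall>x\<in>S. f differentiable (at x)) \<and>
        (\<forall>v. Ck_on k (\<lambda>x. frechet_derivative f (at x) v) S))"

definition smooth_on_set :: "('a::euclidean_space \<Rightarrow> 'b::real_normed_vector) \<Rightarrow> 'a set \<Rightarrow> bool" where
  "smooth_on_set f S \<longleftrightarrow> (\<forall>k. Ck_on k f S)"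

definition pd :: "(real^('m::finite) \<Rightarrow> 'b::real_normed_vector) \<Rightarrow> 'm \<Rightarrow> real^'m \<Rightarrow> 'b" where
  "pd f i x = frechet_derivative f (at x) (axis i 1)"

definition gform :: "real^('m::finite)^'m \<Rightarrow> real^'m \<Rightarrow> real^'m \<Rightarrow> real" where
  "gform G u v = u \<bullet> (G *v v)"

definition riem_metric :: "('m::finite) mfield \<Rightarrow> bool" where
  "riem_metric g \<longleftrightarrow> smooth_on_set g (ball 0 1) \<and>
     (\<forall>x\<in>ball 0 1. transpose (g x) = g x \<and> (\<forall>v. v \<noteq> 0 \<longrightarrow> gform (g x) v v > 0))"

definition christ :: "('m::finite) mfield \<Rightarrow> 'm \<Rightarrow> 'm \<Rightarrow> 'm \<Rightarrow> real^'m \<Rightarrow> real" where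
  "christ g l i j x = (1/2) * (\<Sum>m\<in>UNIV. matrix_inv (g x) $ l $ m *
       (pd g i x $ j $ m + pd g j x $ i $ m - pd g m x $ i $ j))"

text \<open>Riemann tensor R^l_{ijk}, with R(d_i,d_j)d_k = R^l_{ijk} d_l and
  R(X,Y) = nabla_X nabla_Y - nabla_Y nabla_X - nabla_[X,Y].\<close>
definition riem :: "('m::finite) mfield \<Rightarrow> 'm \<Rightarrow> 'm \<Rightarrow> 'm \<Rightarrow> 'm \<Rightarrow> real^'m \<Rightarrow> real" where
  "riem g l i j k x = pd (christ g l j k) i x - pd (christ g l i k) j x
     + (\<Sum>m\<in>UNIV. christ g m j k x * christ g l i m x - christ g m i k x * christ g l j m x)"

definition ricci :: "('m::finite) mfield \<Rightarrow> 'm \<Rightarrow> 'm \<Rightarrow> real^'m \<Rightarrow> real" where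
  "ricci g j k x = (\<Sum>i\<in>UNIV. riem g i i j k x)"

definition riem_vec :: "('m::finite) mfield \<Rightarrow> real^'m \<Rightarrow> real^'m \<Rightarrow> real^'m \<Rightarrow> real^'m \<Rightarrow> real^'m" where
  "riem_vec g x X Y Z = (\<chi> l. \<Sum>i\<in>UNIV. \<Sum>j\<in>UNIV. \<Sum>k\<in>UNIV. X$i * Y$j * Z$k * riem g l i j k x)"

definition sec_curv :: "('m::finite) mfield \<Rightarrow> real^'m \<Rightarrow> real^'m \<Rightarrow> real^'m \<Rightarrow> real" where
  "sec_curv g x X Y = gform (g x) (riem_vec g x X Y Y) X /
     (gform (g x) X X * gform (g x) Y Y - (gform (g x) X Y)^2)"

definition lin_indep2 :: "real^('m::finite) \<Rightarrow> real^'m \<Rightarrow> bool" where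
  "lin_indep2 X Y \<longleftrightarrow> X \<noteq> 0 \<and> (\<forall>c. Y \<noteq> c *\<^sub>R X)"

definition nonpos_curved :: "('m::finite) mfield \<Rightarrow> bool" where
  "nonpos_curved g \<longleftrightarrow> (\<forall>p\<in>ball 0 1. \<forall>X Y. lin_indep2 X Y \<longrightarrow> sec_curv g p X Y \<le> 0)"

definition einstein_neg :: "('m::finite) mfield \<Rightarrow> bool" where
  "einstein_neg g \<longleftrightarrow> (\<forall>x\<in>ball 0 1. \<forall>j k.
       ricci g j k x = - (real CARD('m) - 1) * (g x $ j $ k))"

definition rlength :: "('m::finite) mfield \<Rightarrow> (real \<Rightarrow> real^'m) \<Rightarrow> real" where
  "rlength g \<gamma> = integral {0..1} (\<lambda>t. sqrt (gform (g (\<gamma> t))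
        (vector_derivative \<gamma> (at t)) (vector_derivative \<gamma> (at t))))"

definition rdist :: "('m::finite) mfield \<Rightarrow> real^'m \<Rightarrow> real^'m \<Rightarrow> real" where
  "rdist g p q = Inf {rlength g \<gamma> | \<gamma>. \<gamma> C1_differentiable_on {0..1} \<and>
        \<gamma> 0 = p \<and> \<gamma> 1 = q \<and> \<gamma> ` {0..1} \<subseteq> ball 0 1}"

definition complete_metric :: "('m::finite) mfield \<Rightarrow> bool" where
  "complete_metric g \<longleftrightarrow> (\<forall>s. (\<forall>n. s n \<in> ball 0 1) \<and>
      (\<forall>e>0. \<exists>N. \<forall>m\<ge>N. \<forall>n\<ge>N. rdist g (s m) (s n) < e) \<longrightarrow>
      (\<exists>q\<in>ball 0 1. (\<lambda>n. rdist g (s n) q) \<longlonglongrightarrow> 0))"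

definition defining_fun :: "(real^('m::finite) \<Rightarrow> real) \<Rightarrow> bool" where
  "defining_fun x \<longleftrightarrow> continuous_on (cball 0 1) x \<and> (\<forall>p\<in>ball 0 1. x p > 0) \<and>
     (\<forall>p\<in>sphere 0 1. x p = 0 \<and> x differentiable (at p) \<and> frechet_derivative x (at p) \<noteq> (\<lambda>_. 0))"

text \<open>The homogeneous metric ghat^lambda = sigma_1^2 + lambda (sigma_2^2+...+sigma_n^2) on
  S^n = SU(k+1)/SU(k) in C^(k+1) = R^(2k+2) with complex structure J: sigma_1 = <J p, .>
  (Hopf fibre direction), and sigma_2^2+...+sigma_n^2 = round metric - sigma_1^2.\<close>
definition ghat :: "real^('m::finite)^'m \<Rightarrow> real \<Rightarrow> real^'m \<Rightarrow> real^'m \<Rightarrow> real^'m \<Rightarrow> real" where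
  "ghat J lam p u v = ((J *v p) \<bullet> u) * ((J *v p) \<bullet> v)
      + lam * (u \<bullet> v - ((J *v p) \<bullet> u) * ((J *v p) \<bullet> v))"

definition CCE_with_infinity :: "real^('m::finite)^'m \<Rightarrow> real \<Rightarrow> 'm mfield \<Rightarrow> bool" where
  "CCE_with_infinity J lam g \<longleftrightarrow> riem_metric g \<and> complete_metric g \<and> einstein_neg g \<and>
     (\<exists>x gbar c. defining_fun x \<and> continuous_on (cball 0 1) gbar \<and>
        (\<forall>p\<in>ball 0 1. gbar p = (x p)^2 *\<^sub>R g p) \<and>
        (\<forall>p\<in>sphere 0 1. c p > 0 \<and> (\<forall>u v. u \<bullet> p = 0 \<longrightarrow> v \<bullet> p = 0 \<longrightarrow>
            gform (gbar p) u v = c p * ghat J lam p u v)))"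

end

theory Submission
  imports Defs "HOL-Computational_Algebra.Polynomial"
begin

text \<open>The metrics are explicit: they form the higher-dimensional Taub-NUT-AdS family. Identify
  \<open>\<real>\<^sup>n\<^sup>+\<^sup>1\<close> with \<open>\<complex>\<^sup>k\<^sup>+\<^sup>1\<close> and put \<open>t = |z|\<^sup>2\<close>, \<open>w = Jz\<close>, \<open>\<kappa> = 1/\<lambda>\<close>. With a hypergeometric polynomial \<open>P\<close> of
  degree \<open>k\<close> let \<open>c = (\<kappa> - 1) P(t)\<close> and \<open>u = 1 + t c\<close>; then the metric \<open>g = 4\<kappa>/(1-t)\<^sup>2 h\<close>, where
  \<open>h = I - (c/u) z z\<^sup>T + c w w\<^sup>T\<close>, is Einstein, is conformally compact because \<open>u > 0\<close> on \<open>[0,1]\<close>, and has the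
  conformal infinity of parameter \<open>\<lambda>\<close> because \<open>u(1) = \<kappa>\<close>. The curvature tensor of \<open>h\<close> is a combination of
  Kulkarni-Nomizu products and of squares of two-forms, and the conformal factor only adds a
  Kulkarni-Nomizu product. After moving the tangent planes to a fixed Euclidean model by the square
  root of \<open>h\<close>, the sectional curvature of \<open>g\<close> is \<open>-1 + (\<lambda> - 1) W\<close> with \<open>W\<close> independent of \<open>\<lambda>\<close>. The function
  \<open>W\<close> is continuous on the compact set of points of the closed ball with an orthonormal pair and
  vanishes over the sphere, so its extrema are the reciprocals of the values of \<open>\<lambda> - 1\<close> at which
  nonpositivity fails, and they are attained over the open ball whenever they matter.\<close>

section \<open>Linear algebra and the unit ball\<close>

lemma norm_matrix_vector_mult_le:
  fixes A :: "real^'n^'m"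
  shows "norm (A *v x) \<le> norm A * norm x"
proof -
  have "norm (A *v x) \<le> L2_set (\<lambda>i. norm (A $ i) * norm x) UNIV"
    unfolding norm_vec_def[of "A *v x"]
    by (intro L2_set_mono) (auto simp: matrix_vector_mul_component Cauchy_Schwarz_ineq2)
  also have "\<dots> = norm A * norm x"
    by (simp add: norm_vec_def[of A] L2_set_left_distrib)
  finally show ?thesis .
qed

lemma bounded_bilinear_matrix_vector_mult:
  "bounded_bilinear ((*v) :: real^'n^'m \<Rightarrow> real^'n \<Rightarrow> real^'m)"
proof
  show "\<exists>K. \<forall>(A::real^'n^'m) x. norm (A *v x) \<le> norm A * norm x * K"
    by (intro exI[of _ 1]) (simp add: norm_matrix_vector_mult_le)
qed (simp_all add: matrix_vector_right_distrib matrix_vector_mult_add_rdistrib matrix_vector_mult_scaleR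
    scaleR_matrix_vector_assoc)

lemmas continuous_on_matrix_vector_mult =
  bounded_bilinear.continuous_on[OF bounded_bilinear_matrix_vector_mult]

definition outer :: "real^'m \<Rightarrow> real^'n \<Rightarrow> real^'n^'m" where
  "outer x y = (\<chi> i j. x $ i * y $ j)"

lemma outer_mult_vector: "outer x y *v v = (y \<bullet> v) *\<^sub>R x"
  by (simp add: vec_eq_iff outer_def matrix_vector_mult_def inner_vec_def sum_distrib_left mult_ac)

lemma bounded_bilinear_outer: "bounded_bilinear (outer :: real^'m \<Rightarrow> real^'n \<Rightarrow> real^'n^'m)"
  unfolding bilinear_conv_bounded_bilinear[symmetric] bilinear_def
  by (auto intro!: linearI simp: vec_eq_iff outer_def algebra_simps)

lemma gform_matrix_simps:
  "gform (A + B) x y = gform A x y + gform B x y"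
  "gform (A - B) x y = gform A x y - gform B x y"
  "gform (r *\<^sub>R A) x y = r * gform A x y"
  "gform (mat 1) x y = x \<bullet> y"
  "gform (outer v w) x y = (v \<bullet> x) * (w \<bullet> y)"
  by (simp_all add: gform_def outer_mult_vector inner_simps algebra_simps
      scaleR_matrix_vector_assoc[symmetric] inner_commute)

lemma gform_linear_simps:
  "gform A (x + y) v = gform A x v + gform A y v"
  "gform A (r *\<^sub>R x) v = r * gform A x v"
  "gform A v (x + y) = gform A v x + gform A v y"
  "gform A v (r *\<^sub>R x) = r * gform A v x"
  "gform A (x - y) v = gform A x v - gform A y v"
  "gform A v (x - y) = gform A v x - gform A v y"
  "gform A 0 v = 0"
  by (simp_all add: gform_def algebra_simps inner_simps matrix_vector_mult_diff_distrib)

lemma gform_commute: "transpose A = A \<Longrightarrow> gform A x y = gform A y x"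
  by (metis gform_def dot_lmul_matrix inner_commute transpose_matrix_vector)

lemma gform_le: "gform A v v \<le> norm A * (norm v)\<^sup>2"
proof -
  have "gform A v v \<le> norm v * norm (A *v v)"
    unfolding gform_def by (rule norm_cauchy_schwarz)
  also have "\<dots> \<le> norm v * (norm A * norm v)"
    by (intro mult_left_mono norm_matrix_vector_mult_le) auto
  finally show ?thesis by (simp add: power2_eq_square mult_ac)
qed

lemma continuous_on_gform:
  assumes "continuous_on S A" "continuous_on S v" "continuous_on S w"
  shows "continuous_on S (\<lambda>x. gform (A x) (v x) (w x))"
  unfolding gform_def using assms by (intro continuous_on_inner continuous_on_matrix_vector_mult)

lemma linear_axis_expansion:
  fixes L :: "real^'m \<Rightarrow> 'b::real_vector"
  assumes "linear L"
  shows "(\<Sum>i\<in>UNIV. v $ i *\<^sub>R L (axis i 1)) = L v"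
proof -
  have "L v = L (\<Sum>i\<in>UNIV. v $ i *\<^sub>R axis i 1)"
    using basis_expansion[of v] by (simp add: scalar_mult_eq_scaleR)
  then show ?thesis by (simp add: linear_sum[OF assms] linear_scale[OF assms])
qed

lemma trace_matrix: "trace (matrix L) = (\<Sum>i\<in>UNIV. L (axis i 1) $ i)"
  by (simp add: trace_def matrix_def)

lemma trace_matrix_simps:
  fixes L M :: "real^'m \<Rightarrow> real^'m"
  shows "trace (matrix (\<lambda>v. L v + M v)) = trace (matrix L) + trace (matrix M)"
    and "trace (matrix (\<lambda>v. L v - M v)) = trace (matrix L) - trace (matrix M)"
    and "trace (matrix (\<lambda>v. r *\<^sub>R L v)) = r * trace (matrix L)"
    and "trace (matrix (\<lambda>v::real^'m. v)) = real CARD('m)"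
  by (simp_all add: trace_matrix sum.distrib sum_subtractf sum_distrib_left)

lemma trace_matrix_functional:
  fixes \<phi> :: "real^'m \<Rightarrow> real"
  assumes "linear \<phi>"
  shows "trace (matrix (\<lambda>v. \<phi> v *\<^sub>R w)) = \<phi> w"
  using linear_axis_expansion[OF assms, of w] by (simp add: trace_matrix mult.commute)

lemma trace_matrix_skew:
  fixes L :: "real^'m \<Rightarrow> real^'m"
  assumes "\<And>v. L v \<bullet> v = 0"
  shows "trace (matrix L) = 0"
  using assms[of "axis _ 1"] by (simp add: trace_matrix inner_axis)

lemma trace_matrix_conjugate:
  fixes A B :: "real^'m^'m"
  assumes "linear L" "B ** A = mat 1"
  shows "trace (matrix (\<lambda>v. A *v L (B *v v))) = trace (matrix L)"
proof -
  have "matrix (\<lambda>v. A *v L (B *v v)) = A ** (matrix L ** B)"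
    using assms(1) linear_compose[OF
        linear_compose[OF matrix_vector_mul_linear[of B] assms(1)] matrix_vector_mul_linear[of A]]
    by (intro matrix_eq[THEN iffD2]) (simp add: o_def matrix_works matrix_vector_mul_assoc[symmetric])
  then show ?thesis
    by (simp add: trace_mul_sym[of A] matrix_mul_assoc[symmetric] assms(2))
qed

definition gram :: "'a::real_inner \<Rightarrow> 'a \<Rightarrow> real" where
  "gram X Y = (X \<bullet> X) * (Y \<bullet> Y) - (X \<bullet> Y)\<^sup>2"

lemma gram_pos:
  assumes "lin_indep2 X Y"
  shows "gram X Y > 0"
proof -
  have X: "X \<bullet> X > 0" using assms by (simp add: lin_indep2_def)
  define v where "v = Y - ((X \<bullet> Y) / (X \<bullet> X)) *\<^sub>R X"
  have "v \<noteq> 0" using assms by (auto simp: v_def lin_indep2_def)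
  then have "(X \<bullet> X) * (v \<bullet> v) > 0" using X by simp
  also have "(X \<bullet> X) * (v \<bullet> v) = gram X Y"
    using X by (simp add: v_def gram_def inner_diff_left inner_diff_right inner_commute
        field_simps power2_eq_square)
  finally show ?thesis .
qed

lemma gram_schmidt_pair:
  fixes X Y :: "real^'m"
  assumes "lin_indep2 X Y"
  obtains a b d where "norm (a *\<^sub>R X) = 1" "norm (b *\<^sub>R Y + d *\<^sub>R X) = 1"
    "(a *\<^sub>R X) \<bullet> (b *\<^sub>R Y + d *\<^sub>R X) = 0" "(a * b)\<^sup>2 * gram X Y = 1"
proof -
  define n where "n = X \<bullet> X"
  have n: "n > 0" using assms by (simp add: n_def lin_indep2_def)
  define a where "a = 1 / sqrt n"
  define b where "b = sqrt n / sqrt (gram X Y)"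
  define d where "d = - b * (X \<bullet> Y) / n"
  have a: "a\<^sup>2 * n = 1" using n by (simp add: a_def power_divide)
  have b: "b\<^sup>2 * gram X Y = n" using n gram_pos[OF assms] by (simp add: b_def power_divide)
  have d: "d * n = - b * (X \<bullet> Y)" using n by (simp add: d_def)
  show ?thesis
  proof (rule that)
    show "norm (a *\<^sub>R X) = 1"
      using a unfolding norm_eq_1 by (simp add: n_def[symmetric] power2_eq_square mult.assoc)
    have "(a *\<^sub>R X) \<bullet> (b *\<^sub>R Y + d *\<^sub>R X) = a * (b * (X \<bullet> Y) + d * n)"
      by (simp add: inner_add_right n_def distrib_left)
    then show "(a *\<^sub>R X) \<bullet> (b *\<^sub>R Y + d *\<^sub>R X) = 0" unfolding d by simp
    have "n * ((b *\<^sub>R Y + d *\<^sub>R X) \<bullet> (b *\<^sub>R Y + d *\<^sub>R X))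
        = b\<^sup>2 * (n * (Y \<bullet> Y)) + 2 * b * (d * n) * (X \<bullet> Y) + (d * n)\<^sup>2"
      unfolding inner_simps inner_commute[of Y X] n_def[symmetric] by algebra
    also have "\<dots> = b\<^sup>2 * gram X Y" unfolding d gram_def n_def[symmetric] by algebra
    finally show "norm (b *\<^sub>R Y + d *\<^sub>R X) = 1" using b n by (simp add: norm_eq_1)
    have "(a * b)\<^sup>2 * gram X Y = a\<^sup>2 * (b\<^sup>2 * gram X Y)" by algebra
    then show "(a * b)\<^sup>2 * gram X Y = 1" unfolding b a .
  qed
qed

lemma orthonormal_lin_indep2: "norm X = 1 \<Longrightarrow> norm Y = 1 \<Longrightarrow> X \<bullet> Y = 0 \<Longrightarrow> lin_indep2 X Y"
  by (auto simp: lin_indep2_def)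

lemma lin_indep2_image:
  assumes "A ** B = mat 1" "lin_indep2 X Y"
  shows "lin_indep2 (B *v X) (B *v Y)"
proof -
  have "A *v (B *v v) = v" for v by (simp add: matrix_vector_mul_assoc assms(1))
  then show ?thesis
    using assms(2) unfolding lin_indep2_def
    by (metis matrix_vector_mult_0_right matrix_vector_mult_scaleR)
qed

lemma inner_self_less_1: "z \<in> ball 0 1 \<Longrightarrow> z \<bullet> z < 1"
  by (simp add: power2_norm_eq_inner[symmetric] abs_square_less_1)

lemma inner_self_unit_interval:
  "z \<in> ball 0 1 \<Longrightarrow> z \<bullet> z \<in> {0..1}" "z \<in> cball 0 1 \<Longrightarrow> z \<bullet> z \<in> {0..1}"
  by (auto simp: power2_norm_eq_inner[symmetric] abs_square_le_1)

lemma real_derivative_of_inner_self: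
  assumes "(F has_real_derivative F') (at (z \<bullet> z))"
  shows "((\<lambda>z::'a::real_inner. F (z \<bullet> z)) has_derivative (\<lambda>V. 2 * (z \<bullet> V) * F')) (at z)"
proof -
  have "((\<lambda>z. z \<bullet> z) has_derivative (\<lambda>V. 2 * (z \<bullet> V))) (at z)"
    by (auto intro!: derivative_eq_intros simp: inner_commute)
  from has_derivative_compose[OF this assms[unfolded has_field_derivative_def]]
  show ?thesis by (simp add: mult_ac)
qed

lemma continuous_on_radial:
  assumes "continuous_on {0..1} F"
  shows "continuous_on (cball 0 1) (\<lambda>z::real^'m. F (z \<bullet> z))"
  by (rule continuous_on_compose2[OF assms]) (auto intro!: continuous_intros dest: inner_self_unit_interval(2))

lemma defining_fun_1_minus_inner_self: "defining_fun (\<lambda>p::real^'m. 1 - p \<bullet> p)"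
  unfolding defining_fun_def
proof (intro conjI ballI)
  show "continuous_on (cball 0 1) (\<lambda>p::real^'m. 1 - p \<bullet> p)" by (intro continuous_intros)
  show "1 - p \<bullet> p > 0" if "p \<in> ball 0 1" for p :: "real^'m"
    using inner_self_less_1[OF that] by simp
  fix p :: "real^'m" assume "p \<in> sphere 0 1"
  then have p: "p \<bullet> p = 1" by (simp add: norm_eq_1)
  have deriv: "((\<lambda>p. 1 - p \<bullet> p) has_derivative (\<lambda>v. - 2 * (p \<bullet> v))) (at p)"
    by (auto intro!: derivative_eq_intros simp: inner_commute)
  show "1 - p \<bullet> p = 0" by (simp add: p)
  show "(\<lambda>p. 1 - p \<bullet> p) differentiable (at p)" using deriv differentiable_def by blast
  have "- 2 * (p \<bullet> p) \<noteq> 0" by (simp add: p)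
  then show "frechet_derivative (\<lambda>p. 1 - p \<bullet> p) (at p) \<noteq> (\<lambda>_. 0)"
    unfolding frechet_derivative_at[OF deriv, symmetric] by metis
qed

section \<open>The radial profile\<close>

lemma positive_on_interval_if_increasing_where_nonpos:
  fixes F F' :: "real \<Rightarrow> real"
  assumes deriv: "\<And>s. s \<in> {a..b} \<Longrightarrow> (F has_real_derivative F' s) (at s)"
    and initial: "F a > 0"
    and increasing: "\<And>s. a < s \<Longrightarrow> s \<le> b \<Longrightarrow> F s \<le> 0 \<Longrightarrow> F' s > 0"
    and t: "t \<in> {a..b}"
  shows "F t > 0"
proof -
  have "continuous_on {a..b} F"
    using deriv DERIV_isCont continuous_at_imp_continuous_on by blast
  then obtain s where s: "s \<in> {a..b}" and minimal: "\<And>r. r \<in> {a..b} \<Longrightarrow> F s \<le> F r"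
    using continuous_attains_inf[of "{a..b}" F] t by auto
  have "F s > 0"
  proof (rule ccontr)
    assume "\<not> F s > 0"
    then have "a < s" "F' s > 0" using initial increasing s by (cases "s = a"; auto)+
    then obtain d where d: "d > 0" "\<And>r. 0 < r \<Longrightarrow> r < d \<Longrightarrow> F (s - r) < F s"
      using DERIV_pos_inc_left[OF deriv[OF s]] by blast
    define r where "r = min (d / 2) (s - a)"
    have r: "0 < r" "r < d" "s - r \<in> {a..b}" using d(1) \<open>a < s\<close> s by (auto simp: r_def)
    show False using d(2)[OF r(1,2)] minimal[OF r(3)] by simp
  qed
  then show ?thesis using minimal[OF t] by simp
qed

text \<open>The Taylor coefficients of \<open>(4k+2)/(k+2) F(-k, 2; k+3; t)\<close>. The normalization gives the profile the
  value \<open>1\<close> at \<open>t = 1\<close>.\<close>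
fun profile_coeff :: "nat \<Rightarrow> nat \<Rightarrow> real" where
  "profile_coeff k 0 = (4 * real k + 2) / (real k + 2)"
| "profile_coeff k (Suc j) =
     - ((real k - real j) * (real j + 2) / ((real j + 1) * (real k + 3 + real j))) * profile_coeff k j"

definition profile :: "nat \<Rightarrow> real poly" where
  "profile k = (\<Sum>j\<le>k. monom (profile_coeff k j) j)"

lemma profile_coeff_eq_0: "j > k \<Longrightarrow> profile_coeff k j = 0"
proof (induction j)
  case (Suc j)
  then show ?case by (cases "j = k") auto
qed simp

lemma coeff_profile: "coeff (profile k) j = profile_coeff k j"
proof -
  have "coeff (profile k) j = (\<Sum>i\<le>k. if i = j then profile_coeff k j else 0)"
    unfolding profile_def coeff_sum by (intro sum.cong) auto
  then show ?thesis by (simp add: profile_coeff_eq_0)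
qed

lemma profile_coeff_recurrence:
  "(real j + 1) * (real k + 3 + real j) * profile_coeff k (Suc j)
     + (real k - real j) * (real j + 2) * profile_coeff k j = 0"
proof -
  have "real j + 1 \<noteq> 0" "real k + 3 + real j \<noteq> 0" by linarith+
  then show ?thesis by simp
qed

lemma profile_hypergeometric_poly:
  "[:0, 1, -1:] * pderiv (pderiv (profile k)) + [:real k + 3, real k - 3:] * pderiv (profile k)
     + smult (2 * real k) (profile k) = 0"
proof (rule poly_eqI)
  fix j
  have "coeff ([:0, 1, -1:] * pderiv (pderiv (profile k)) + [:real k + 3, real k - 3:] * pderiv (profile k)
     + smult (2 * real k) (profile k)) j
    = (real j + 1) * (real k + 3 + real j) * profile_coeff k (Suc j)
     + (real k - real j) * (real j + 2) * profile_coeff k j"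
    by (cases j; cases "j - 1")
      (simp_all add: coeff_pderiv coeff_profile algebra_simps del: profile_coeff.simps)
  then show "coeff ([:0, 1, -1:] * pderiv (pderiv (profile k)) + [:real k + 3, real k - 3:] * pderiv (profile k)
     + smult (2 * real k) (profile k)) j = coeff 0 j"
    using profile_coeff_recurrence by simp
qed

lemma profile_hypergeometric:
  "t * (1 - t) * poly (pderiv (pderiv (profile k))) t
     + (real k + 3 + (real k - 3) * t) * poly (pderiv (profile k)) t + 2 * real k * poly (profile k) t = 0"
  using arg_cong[OF profile_hypergeometric_poly[of k], of "\<lambda>p. poly p t"] by (simp add: algebra_simps)

text \<open>The first integral of the hypergeometric equation: the derivative of the left-hand side is
  \<open>1 + t\<close> times that equation.\<close>
lemma profile_first_integral:
  "t * (1 - t\<^sup>2) * poly (pderiv (profile k)) t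
     + (real k + 2 + 2 * real k * t + real k * t\<^sup>2) * poly (profile k) t = 4 * real k + 2"
proof -
  let ?p = "poly (profile k)" and ?p' = "poly (pderiv (profile k))"
    and ?p'' = "poly (pderiv (pderiv (profile k)))"
  define E where "E s = s * (1 - s\<^sup>2) * ?p' s + (real k + 2 + 2 * real k * s + real k * s\<^sup>2) * ?p s" for s
  have "(E has_real_derivative
      (1 + s) * (s * (1 - s) * ?p'' s + (real k + 3 + (real k - 3) * s) * ?p' s + 2 * real k * ?p s)) (at s)"
    for s
    unfolding E_def by (auto intro!: derivative_eq_intros poly_DERIV simp: algebra_simps power2_eq_square)
  then have "(E has_real_derivative 0) (at s)" for s
    unfolding profile_hypergeometric by simp
  then have "E t = E 0" by (intro DERIV_isconst_all) simp
  then show ?thesis by (simp add: E_def poly_0_coeff_0 coeff_profile)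
qed

lemma profile_at_1: "poly (profile k) 1 = 1"
proof -
  have "(4 * real k + 2) * (poly (profile k) 1 - 1) = 0"
    using profile_first_integral[of 1 k] by (simp add: algebra_simps)
  moreover have "4 * real k + 2 \<noteq> 0" using of_nat_0_le_iff[of k] by linarith
  ultimately show ?thesis by simp
qed

lemma profile_factor_pos:
  assumes "\<kappa> > 0" and "t \<in> {0..1}"
  shows "1 + t * ((\<kappa> - 1) * poly (profile k) t) > 0"
proof (rule positive_on_interval_if_increasing_where_nonpos[OF _ _ _ assms(2)])
  let ?p = "poly (profile k)" and ?p' = "poly (pderiv (profile k))"
  let ?u' = "\<lambda>s. (\<kappa> - 1) * (?p s + s * ?p' s)"
  show "((\<lambda>s. 1 + s * ((\<kappa> - 1) * ?p s)) has_real_derivative ?u' s) (at s)" for s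
    by (auto intro!: derivative_eq_intros poly_DERIV simp: algebra_simps)
  fix s :: real assume s: "0 < s" "s \<le> 1" and nonpos: "1 + s * ((\<kappa> - 1) * ?p s) \<le> 0"
  have "s \<noteq> 1" using nonpos assms(1) by (auto simp: profile_at_1)
  then have s1: "s * (1 - s\<^sup>2) > 0" using s by (simp add: power_less_one_iff)
  have "s * (1 - s\<^sup>2) * ?u' s + ((real k + 1) * (1 + s\<^sup>2) + 2 * real k * s) * (1 + s * ((\<kappa> - 1) * ?p s))
      = (real k + 1) * (1 - s)\<^sup>2 + \<kappa> * (4 * real k + 2) * s"
    using profile_first_integral[of s k] by algebra
  moreover have "(real k + 1) * (1 - s)\<^sup>2 + \<kappa> * (4 * real k + 2) * s > 0"
    using s assms(1) by (intro add_nonneg_pos mult_pos_pos) auto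
  moreover have "((real k + 1) * (1 + s\<^sup>2) + 2 * real k * s) * (1 + s * ((\<kappa> - 1) * ?p s)) \<le> 0"
    using s nonpos by (intro mult_nonneg_nonpos) auto
  ultimately have "s * (1 - s\<^sup>2) * ?u' s > 0" by linarith
  then show "?u' s > 0" using s1 zero_less_mult_pos by blast
qed simp

section \<open>Calculus of Ck functions\<close>

lemma Ck_on_cong:
  assumes "open S" "\<And>x. x \<in> S \<Longrightarrow> f x = g x" "Ck_on n f S"
  shows "Ck_on n g S"
  using assms(2,3)
proof (induction n arbitrary: f g)
  case 0
  then show ?case by (metis Ck_on.simps(1) continuous_on_cong)
next
  case (Suc n)
  have "g differentiable (at x)" if "x \<in> S" for x
    using Suc.prems assms(1) that
    by (metis Ck_on.simps(2) differentiable_def has_derivative_transform_within_open)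
  moreover have "Ck_on n (\<lambda>x. frechet_derivative g (at x) v) S" for v
  proof (rule Suc.IH)
    show "Ck_on n (\<lambda>x. frechet_derivative f (at x) v) S" using Suc.prems by simp
    show "frechet_derivative f (at x) v = frechet_derivative g (at x) v" if "x \<in> S" for x
      using Suc.prems assms(1) that
      by (metis Ck_on.simps(2) frechet_derivative_transform_within_open)
  qed
  ultimately show ?case by simp
qed

lemma Ck_on_Suc_imp_Ck_on: "Ck_on (Suc n) f S \<Longrightarrow> Ck_on n f S"
proof (induction n arbitrary: f)
  case 0
  then show ?case
    by (auto intro!: continuous_at_imp_continuous_on differentiable_imp_continuous_within)
next
  case (Suc n)
  then show ?case by (metis Ck_on.simps(2))
qed

lemma Ck_on_Suc_intro:
  assumes "open S" "\<And>x. x \<in> S \<Longrightarrow> (f has_derivative f' x) (at x)"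
    and "\<And>v. Ck_on n (\<lambda>x. f' x v) S"
  shows "Ck_on (Suc n) f S"
proof -
  have "Ck_on n (\<lambda>x. frechet_derivative f (at x) v) S" for v
    using assms(1) _ assms(3)[of v]
    by (rule Ck_on_cong) (use assms(2) frechet_derivative_at in metis)
  then show ?thesis using assms(2) by (auto simp: differentiable_def)
qed

lemma Ck_on_Suc_has_derivative:
  assumes "Ck_on (Suc n) f S" "x \<in> S"
  shows "(f has_derivative frechet_derivative f (at x)) (at x)"
  using assms frechet_derivative_works by auto

lemma Ck_on_const: "open S \<Longrightarrow> Ck_on n (\<lambda>x. c) S"
  by (induction n arbitrary: c) (auto intro!: Ck_on_Suc_intro)

lemma Ck_on_linear:
  assumes "open S" "bounded_linear L"
  shows "Ck_on n L S"
proof (cases n)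
  case 0
  then show ?thesis by (simp add: assms linear_continuous_on)
next
  case (Suc j)
  show ?thesis unfolding Suc
    using assms by (intro Ck_on_Suc_intro[where f' = "\<lambda>x. L"] Ck_on_const)
      (auto intro: bounded_linear_imp_has_derivative)
qed

lemma Ck_on_add:
  assumes "open S" "Ck_on n f S" "Ck_on n g S"
  shows "Ck_on n (\<lambda>x. f x + g x) S"
  using assms(2,3)
proof (induction n arbitrary: f g)
  case 0
  then show ?case by (simp add: continuous_on_add)
next
  case (Suc n)
  note derivs = Suc.prems[THEN Ck_on_Suc_has_derivative]
  show ?case
    by (rule Ck_on_Suc_intro[OF assms(1) has_derivative_add[OF derivs]]) (use Suc in auto)
qed

lemma Ck_on_bilinear:
  fixes f :: "'a::euclidean_space \<Rightarrow> 'b::real_normed_vector"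
    and g :: "'a \<Rightarrow> 'c::real_normed_vector" and prd :: "'b \<Rightarrow> 'c \<Rightarrow> 'd::real_normed_vector"
  assumes "bounded_bilinear prd" "open S" "Ck_on n f S" "Ck_on n g S"
  shows "Ck_on n (\<lambda>x. prd (f x) (g x)) S"
  using assms(3,4)
proof (induction n arbitrary: f g)
  case 0
  then show ?case by (simp add: bounded_bilinear.continuous_on[OF assms(1)])
next
  case (Suc n)
  note derivs = Suc.prems[THEN Ck_on_Suc_has_derivative]
  show ?case
    using Suc.prems[THEN Ck_on_Suc_imp_Ck_on] Suc.prems
    by (intro Ck_on_Suc_intro[OF assms(2) bounded_bilinear.FDERIV[OF assms(1) derivs]]
        Ck_on_add assms(2) Suc.IH) auto
qed

lemmas Ck_on_scaleR = Ck_on_bilinear[OF bounded_bilinear_scaleR]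
  and Ck_on_mult = Ck_on_bilinear[OF bounded_bilinear_mult]
  and Ck_on_inner = Ck_on_bilinear[OF bounded_bilinear_inner]
  and Ck_on_outer = Ck_on_bilinear[OF bounded_bilinear_outer]

lemma Ck_on_inverse:
  fixes f :: "'a::euclidean_space \<Rightarrow> real"
  assumes "open S" "\<And>x. x \<in> S \<Longrightarrow> f x \<noteq> 0" "Ck_on n f S"
  shows "Ck_on n (\<lambda>x. inverse (f x)) S"
  using assms(3)
proof (induction n)
  case 0
  then show ?case using assms(2) by (simp add: continuous_on_inverse)
next
  case (Suc n)
  have IH: "Ck_on n (\<lambda>x. inverse (f x)) S" using Suc Ck_on_Suc_imp_Ck_on by blast
  have deriv: "((\<lambda>x. inverse (f x)) has_derivative
      (\<lambda>v. (-1) * (inverse (f x) * frechet_derivative f (at x) v * inverse (f x)))) (at x)"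
    if "x \<in> S" for x
    using Deriv.has_derivative_inverse[OF assms(2)[OF that] Ck_on_Suc_has_derivative[OF Suc.prems that]]
    by simp
  show ?case
    using Suc.prems by (intro Ck_on_Suc_intro[OF assms(1) deriv] Ck_on_mult assms(1) IH Ck_on_const) auto
qed

lemma Ck_on_poly:
  fixes f :: "'a::euclidean_space \<Rightarrow> real"
  assumes "open S" "Ck_on n f S"
  shows "Ck_on n (\<lambda>x. poly p (f x)) S"
  by (induction p) (auto intro!: Ck_on_const Ck_on_add Ck_on_mult assms)

section \<open>Completeness\<close>

definition curves_in_ball :: "real^'m \<Rightarrow> real^'m \<Rightarrow> (real \<Rightarrow> real^'m) set" where
  "curves_in_ball p q = {\<gamma>. \<gamma> C1_differentiable_on {0..1} \<and> \<gamma> 0 = p \<and> \<gamma> 1 = q \<and> \<gamma> ` {0..1} \<subseteq> ball 0 1}"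

lemma rdist_eq_INF: "rdist g p q = (INF \<gamma>\<in>curves_in_ball p q. rlength g \<gamma>)"
  unfolding rdist_def curves_in_ball_def by (rule arg_cong[where f = Inf]) blast

lemma has_vector_derivative_linepath: "(linepath p q has_vector_derivative q - p) (at t)"
  using has_vector_derivative_linepath_within by blast

lemma linepath_in_curves_in_ball:
  assumes "p \<in> ball 0 1" "q \<in> ball 0 1"
  shows "linepath p q \<in> curves_in_ball p q"
proof -
  have "linepath p q C1_differentiable_on {0..1}"
    unfolding C1_differentiable_on_def
    using has_vector_derivative_linepath by (intro exI[of _ "\<lambda>_. q - p"]) auto
  moreover have "linepath p q ` {0..1} \<subseteq> ball 0 1"
    unfolding linepath_image_01 by (rule closed_segment_subset[OF assms convex_ball])
  ultimately show ?thesis by (simp add: curves_in_ball_def linepath_0' linepath_1')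
qed

lemma continuous_on_speed:
  assumes "continuous_on (ball 0 1) g" "\<gamma> \<in> curves_in_ball p q"
  shows "continuous_on {0..1}
    (\<lambda>t. sqrt (gform (g (\<gamma> t)) (vector_derivative \<gamma> (at t)) (vector_derivative \<gamma> (at t))))"
proof -
  have "continuous_on {0..1} \<gamma>"
    using assms(2) C1_diff_imp_diff differentiable_imp_continuous_on by (auto simp: curves_in_ball_def)
  then have "continuous_on {0..1} (\<lambda>t. g (\<gamma> t))"
    using continuous_on_compose2[OF assms(1)] assms(2) by (auto simp: curves_in_ball_def)
  then show ?thesis
    using assms(2) by (intro continuous_on_real_sqrt continuous_on_gform)
      (auto simp: C1_differentiable_on_eq curves_in_ball_def)
qed

lemma norm_diff_le_rlength:
  fixes F :: "real^'m \<Rightarrow> 'b::euclidean_space"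
  assumes g: "continuous_on (ball 0 1) g" and \<gamma>: "\<gamma> \<in> curves_in_ball p q"
    and deriv: "\<And>x. x \<in> ball 0 1 \<Longrightarrow> (F has_derivative F' x) (at x)"
    and bound: "\<And>x v. x \<in> ball 0 1 \<Longrightarrow> norm (F' x v) \<le> sqrt (gform (g x) v v)"
  shows "norm (F q - F p) \<le> rlength g \<gamma>"
proof -
  let ?v = "\<lambda>t. vector_derivative \<gamma> (at t)"
  have in_ball: "\<gamma> t \<in> ball 0 1" if "t \<in> {0..1}" for t
    using \<gamma> that unfolding curves_in_ball_def by blast
  have "(\<gamma> has_vector_derivative ?v t) (at t)" if "t \<in> {0..1}" for t
    using \<gamma> that by (simp add: curves_in_ball_def C1_differentiable_on_eq vector_derivative_works)
  then have "((\<lambda>t. F (\<gamma> t)) has_vector_derivative F' (\<gamma> t) (?v t)) (at t within {0..1})"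
    if "t \<in> {0..1}" for t
    using vector_derivative_diff_chain_within[of \<gamma> "?v t" t "{0..1}" F "F' (\<gamma> t)"]
      deriv[OF in_ball[OF that]] that
    by (auto simp: o_def intro: has_vector_derivative_at_within has_derivative_at_withinI)
  then have increment: "((\<lambda>t. F' (\<gamma> t) (?v t)) has_integral F (\<gamma> 1) - F (\<gamma> 0)) {0..1}"
    by (intro fundamental_theorem_of_calculus) auto
  have "norm (integral {0..1} (\<lambda>t. F' (\<gamma> t) (?v t))) \<le> rlength g \<gamma>"
    unfolding rlength_def
  proof (rule integral_norm_bound_integral)
    show "(\<lambda>t. F' (\<gamma> t) (?v t)) integrable_on {0..1}" using increment by blast
  qed (use bound[OF in_ball] integrable_continuous_real[OF continuous_on_speed[OF g \<gamma>]] in auto)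
  then show ?thesis using \<gamma> integral_unique[OF increment] by (simp add: curves_in_ball_def)
qed

lemma norm_diff_le_rdist:
  fixes F :: "real^'m \<Rightarrow> 'b::euclidean_space"
  assumes "continuous_on (ball 0 1) g" "p \<in> ball 0 1" "q \<in> ball 0 1"
    and "\<And>x. x \<in> ball 0 1 \<Longrightarrow> (F has_derivative F' x) (at x)"
    and "\<And>x v. x \<in> ball 0 1 \<Longrightarrow> norm (F' x v) \<le> sqrt (gform (g x) v v)"
  shows "norm (F q - F p) \<le> rdist g p q"
  unfolding rdist_eq_INF
  using linepath_in_curves_in_ball[OF assms(2,3)] norm_diff_le_rlength[OF assms(1) _ assms(4,5)]
  by (intro cINF_greatest) auto

locale hyperbolic_lower_bound =
  fixes g :: "('m::finite) mfield" and eps :: real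
  assumes continuous_on_g: "continuous_on (ball 0 1) g" and eps_pos: "eps > 0"
    and lower: "\<And>x v. x \<in> ball 0 1 \<Longrightarrow> (eps * norm v / (1 - x \<bullet> x))\<^sup>2 \<le> gform (g x) v v"
begin

lemma sqrt_gform_lower: "x \<in> ball 0 1 \<Longrightarrow> eps * norm v / (1 - x \<bullet> x) \<le> sqrt (gform (g x) v v)"
  using lower by (intro real_le_rsqrt)

lemma norm_le_rdist:
  assumes "p \<in> ball 0 1" "q \<in> ball 0 1"
  shows "eps * norm (q - p) \<le> rdist g p q"
proof -
  have "norm (eps *\<^sub>R q - eps *\<^sub>R p) \<le> rdist g p q"
  proof (rule norm_diff_le_rdist[OF continuous_on_g assms])
    show "((\<lambda>x. eps *\<^sub>R x) has_derivative (\<lambda>v. eps *\<^sub>R v)) (at x)" for x :: "real^'m"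
      by (auto intro!: derivative_eq_intros)
    fix x v :: "real^'m" assume x: "x \<in> ball 0 1"
    have "eps * norm v * 1 \<le> eps * norm v * (1 / (1 - x \<bullet> x))"
      using inner_self_less_1[OF x] eps_pos by (intro mult_left_mono) (simp_all add: field_simps)
    then show "norm (eps *\<^sub>R v) \<le> sqrt (gform (g x) v v)"
      using sqrt_gform_lower[OF x, of v] eps_pos by simp
  qed
  then show ?thesis using eps_pos by (simp add: scaleR_diff_right[symmetric])
qed

lemma ln_le_rdist:
  assumes "p \<in> ball 0 1" "q \<in> ball 0 1"
  shows "eps / 2 * \<bar>ln (1 - q \<bullet> q) - ln (1 - p \<bullet> p)\<bar> \<le> rdist g p q"
proof -
  have "norm (eps / 2 * ln (1 - q \<bullet> q) - eps / 2 * ln (1 - p \<bullet> p)) \<le> rdist g p q"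
  proof (rule norm_diff_le_rdist[OF continuous_on_g assms])
    fix x v :: "real^'m" assume x: "x \<in> ball 0 1"
    note x1 = inner_self_less_1[OF x]
    show "((\<lambda>x. eps / 2 * ln (1 - x \<bullet> x)) has_derivative (\<lambda>v. - eps * (x \<bullet> v) / (1 - x \<bullet> x))) (at x)"
      using x1 by (auto intro!: derivative_eq_intros simp: inner_commute field_simps)
    have "\<bar>x \<bullet> v\<bar> \<le> norm v"
      using Cauchy_Schwarz_ineq2[of x v] x
      by (meson mem_ball_0 less_imp_le mult_left_le_one_le norm_ge_zero order_trans)
    then have "norm (- eps * (x \<bullet> v) / (1 - x \<bullet> x)) \<le> eps * norm v / (1 - x \<bullet> x)"
      using x1 eps_pos by (simp add: abs_mult divide_right_mono)
    then show "norm (- eps * (x \<bullet> v) / (1 - x \<bullet> x)) \<le> sqrt (gform (g x) v v)"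
      using sqrt_gform_lower[OF x, of v] by linarith
  qed
  then show ?thesis
    using eps_pos unfolding right_diff_distrib[symmetric] by (simp add: abs_mult)
qed

lemma rdist_le_norm:
  assumes K: "convex K" "K \<subseteq> ball 0 1" "p \<in> K" "q \<in> K" and B: "\<And>x. x \<in> K \<Longrightarrow> norm (g x) \<le> B"
  shows "rdist g p q \<le> sqrt B * norm (q - p)"
proof -
  have "p \<in> ball 0 1" "q \<in> ball 0 1" using K by auto
  note segment = linepath_in_curves_in_ball[OF this]
  have "rdist g p q \<le> rlength g (linepath p q)"
    unfolding rdist_eq_INF
  proof (rule cINF_lower[OF _ segment])
    have "0 \<le> rlength g \<gamma>" if "\<gamma> \<in> curves_in_ball p q" for \<gamma>
    proof -
      have "0 \<le> sqrt (gform (g x) v v)" if "x \<in> ball 0 1" for x v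
        using lower[OF that, of v] by (meson order_trans real_sqrt_ge_zero zero_le_power2)
      then show ?thesis
        using norm_diff_le_rlength[OF continuous_on_g that, of "\<lambda>_. 0::real" "\<lambda>_ _. 0"] by simp
    qed
    then show "bdd_below (rlength g ` curves_in_ball p q)" by (intro bdd_belowI2)
  qed
  also have "\<dots> \<le> integral {0..1::real} (\<lambda>t. sqrt B * norm (q - p))"
    unfolding rlength_def
  proof (rule integral_le[OF integrable_continuous_real[OF continuous_on_speed[OF continuous_on_g segment]]])
    fix t :: real assume t: "t \<in> {0..1}"
    have "linepath p q t \<in> K"
      using K(1,3,4) t by (metis closed_segment_subset image_eqI linepath_image_01 subsetD)
    then have "gform (g (linepath p q t)) (q - p) (q - p) \<le> B * (norm (q - p))\<^sup>2"
      using gform_le[of "g (linepath p q t)" "q - p"] mult_right_mono[OF B zero_le_power2]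
      by (blast intro: order_trans)
    then show "sqrt (gform (g (linepath p q t)) (vector_derivative (linepath p q) (at t))
        (vector_derivative (linepath p q) (at t))) \<le> sqrt B * norm (q - p)"
      by (metis real_sqrt_le_mono real_sqrt_mult real_sqrt_abs abs_norm_cancel vector_derivative_linepath_at)
  qed auto
  finally show ?thesis by simp
qed

lemma rdist_Cauchy_imp_bounded_away:
  assumes s: "\<And>n. s n \<in> ball 0 1" and close: "\<And>n. n \<ge> N \<Longrightarrow> rdist g (s N) (s n) < 1"
  obtains R where "R < 1" "\<And>n. n \<ge> N \<Longrightarrow> norm (s n) \<le> R"
proof -
  define L where "L = ln (1 - s N \<bullet> s N) - 2 / eps"
  have L: "exp L \<le> 1 - s n \<bullet> s n" if "n \<ge> N" for n
  proof -
    have "eps / 2 * \<bar>ln (1 - s n \<bullet> s n) - ln (1 - s N \<bullet> s N)\<bar> < 1"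
      using ln_le_rdist[OF s[of N] s[of n]] close[OF that] by linarith
    then have "\<bar>ln (1 - s n \<bullet> s n) - ln (1 - s N \<bullet> s N)\<bar> < 2 / eps"
      using eps_pos by (simp add: field_simps)
    then have "L \<le> ln (1 - s n \<bullet> s n)" unfolding L_def by linarith
    then show ?thesis using inner_self_less_1[OF s[of n]] by (simp add: ln_ge_iff)
  qed
  show ?thesis
  proof (rule that[of "sqrt (1 - exp L)"])
    show "sqrt (1 - exp L) < 1" by simp
    show "norm (s n) \<le> sqrt (1 - exp L)" if "n \<ge> N" for n
      using L[OF that] by (simp add: norm_eq_sqrt_inner)
  qed
qed

lemma rdist_Cauchy_imp_Cauchy:
  assumes s: "\<And>n. s n \<in> ball 0 1" and Cauchy: "\<forall>e>0. \<exists>N. \<forall>m\<ge>N. \<forall>n\<ge>N. rdist g (s m) (s n) < e"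
  shows "Cauchy s"
  unfolding Cauchy_def
proof (intro allI impI)
  fix e :: real assume "e > 0"
  then obtain M where M: "\<And>m n. m \<ge> M \<Longrightarrow> n \<ge> M \<Longrightarrow> rdist g (s m) (s n) < eps * e"
    using Cauchy[rule_format, of "eps * e"] eps_pos by auto
  have "dist (s m) (s n) < e" if "m \<ge> M" "n \<ge> M" for m n
  proof -
    have "eps * norm (s n - s m) < eps * e"
      using norm_le_rdist[OF s s, of n m] M[OF that] by linarith
    then show ?thesis using eps_pos by (simp add: dist_norm norm_minus_commute)
  qed
  then show "\<exists>M. \<forall>m\<ge>M. \<forall>n\<ge>M. dist (s m) (s n) < e" by blast
qed

lemma rdist_tendsto_0:
  assumes R: "R < 1" and s: "\<And>n. n \<ge> N \<Longrightarrow> s n \<in> cball 0 R" and q: "q \<in> cball 0 R" and lim: "s \<longlonglongrightarrow> q"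
  shows "(\<lambda>n. rdist g (s n) q) \<longlonglongrightarrow> 0"
proof -
  have sub: "cball 0 R \<subseteq> ball (0::real^'m) 1" using R by auto
  have "bounded (g ` cball 0 R)"
    by (intro compact_imp_bounded compact_continuous_image compact_cball
        continuous_on_subset[OF continuous_on_g sub])
  then obtain B where B: "\<And>x. x \<in> cball 0 R \<Longrightarrow> norm (g x) \<le> B"
    unfolding bounded_iff by (metis imageI)
  have nonneg: "\<forall>\<^sub>F n in sequentially. 0 \<le> rdist g (s n) q"
    using norm_le_rdist[of "s _" q] s q sub eps_pos
    by (intro eventually_sequentiallyI[of N])
      (meson mult_nonneg_nonneg norm_ge_zero order_trans less_imp_le subsetD)
  have upper: "\<forall>\<^sub>F n in sequentially. rdist g (s n) q \<le> sqrt B * norm (q - s n)"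
    using s q B by (intro eventually_sequentiallyI[of N]) (auto intro!: rdist_le_norm[OF convex_cball sub])
  have "(\<lambda>n. sqrt B * norm (q - s n)) \<longlonglongrightarrow> sqrt B * norm (q - q)"
    by (intro tendsto_intros lim)
  then show ?thesis using tendsto_sandwich[OF nonneg upper tendsto_const] by simp
qed

theorem complete: "complete_metric g"
  unfolding complete_metric_def
proof (intro allI impI, elim conjE)
  fix s :: "nat \<Rightarrow> real^'m"
  assume s: "\<forall>n. s n \<in> ball 0 1"
    and Cauchy: "\<forall>e>0. \<exists>N. \<forall>m\<ge>N. \<forall>n\<ge>N. rdist g (s m) (s n) < e"
  obtain N where "\<And>n. n \<ge> N \<Longrightarrow> rdist g (s N) (s n) < 1"
    using Cauchy[rule_format, of 1] by auto
  then obtain R where R: "R < 1" "\<And>n. n \<ge> N \<Longrightarrow> norm (s n) \<le> R"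
    using rdist_Cauchy_imp_bounded_away s by metis
  obtain q where lim: "s \<longlonglongrightarrow> q"
    using rdist_Cauchy_imp_Cauchy s Cauchy Cauchy_convergent convergent_def by metis
  have q: "q \<in> cball 0 R"
    using Lim_in_closed_set[OF closed_cball _ sequentially_bot lim, of 0 R] R(2)
    by (auto simp: eventually_sequentially)
  then have "(\<lambda>n. rdist g (s n) q) \<longlonglongrightarrow> 0"
    using rdist_tendsto_0[OF R(1) _ q lim, of N] R(2) by simp
  then show "\<exists>q\<in>ball 0 1. (\<lambda>n. rdist g (s n) q) \<longlonglongrightarrow> 0" using q R(1) by auto
qed

end

section \<open>Levi-Civita connections and conformal changes\<close>

text \<open>The curvature at a point of the connection \<open>D + \<Gamma>\<close>, where \<open>\<Gamma>' V X Y\<close> is the derivative of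
  \<open>\<Gamma> X Y\<close> in direction \<open>V\<close>.\<close>
definition connection_curvature ::
    "('a::real_vector \<Rightarrow> 'a \<Rightarrow> 'a) \<Rightarrow> ('a \<Rightarrow> 'a \<Rightarrow> 'a \<Rightarrow> 'a) \<Rightarrow> 'a \<Rightarrow> 'a \<Rightarrow> 'a \<Rightarrow> 'a" where
  "connection_curvature \<Gamma> \<Gamma>' X Y Z = \<Gamma>' X Y Z - \<Gamma>' Y X Z + \<Gamma> X (\<Gamma> Y Z) - \<Gamma> Y (\<Gamma> X Z)"

text \<open>The Kulkarni-Nomizu product of \<open>h\<close> with the symmetric form \<open>h (P X) Y\<close>.\<close>
definition kulkarni_nomizu ::
    "('a::real_vector \<Rightarrow> 'a \<Rightarrow> real) \<Rightarrow> ('a \<Rightarrow> 'a) \<Rightarrow> 'a \<Rightarrow> 'a \<Rightarrow> 'a \<Rightarrow> 'a" where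
  "kulkarni_nomizu h P X Y Z =
     h (P Y) Z *\<^sub>R X - h (P X) Z *\<^sub>R Y + h Y Z *\<^sub>R P X - h X Z *\<^sub>R P Y"

lemma pd_eqI: "(f has_derivative f') (at x) \<Longrightarrow> pd f i x = f' (axis i 1)"
  by (simp add: pd_def frechet_derivative_at[symmetric])

lemma matrix_inv_mult_left:
  fixes A :: "real^'n^'n"
  assumes "invertible A"
  shows "matrix_inv A ** A = mat 1"
  using someI_ex[of "\<lambda>B. A ** B = mat 1 \<and> B ** A = mat 1"] assms
  by (simp add: matrix_inv_def invertible_def)

lemma gform_axis: "gform A (axis i 1) (axis j 1) = A $ i $ j"
  by (simp add: gform_def inner_axis' matrix_vector_mul_component inner_axis)

locale levi_civita =
  fixes S :: "(real^('m::finite)) set" and g :: "'m mfield"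
    and g' :: "real^'m \<Rightarrow> real^'m \<Rightarrow> real^'m^'m"
    and \<Gamma> :: "real^'m \<Rightarrow> real^'m \<Rightarrow> real^'m \<Rightarrow> real^'m"
    and \<Gamma>' :: "real^'m \<Rightarrow> real^'m \<Rightarrow> real^'m \<Rightarrow> real^'m \<Rightarrow> real^'m"
  assumes open_S: "open S"
    and g_deriv: "z \<in> S \<Longrightarrow> (g has_derivative g' z) (at z)"
    and g_sym: "z \<in> S \<Longrightarrow> transpose (g z) = g z"
    and g_pos: "z \<in> S \<Longrightarrow> X \<noteq> 0 \<Longrightarrow> gform (g z) X X > 0"
    and \<Gamma>_deriv: "z \<in> S \<Longrightarrow> ((\<lambda>z. \<Gamma> z X Y) has_derivative (\<lambda>V. \<Gamma>' z V X Y)) (at z)"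
    and \<Gamma>_linear: "z \<in> S \<Longrightarrow> linear (\<Gamma> z X)"
    and torsion_free: "z \<in> S \<Longrightarrow> \<Gamma> z X Y = \<Gamma> z Y X"
    and compatible: "z \<in> S \<Longrightarrow> gform (g' z V) X Y = gform (g z) (\<Gamma> z V X) Y + gform (g z) X (\<Gamma> z V Y)"
begin

lemmas g_commute = gform_commute[OF g_sym]
  and \<Gamma>_add = linear_add[OF \<Gamma>_linear] and \<Gamma>_scale = linear_scale[OF \<Gamma>_linear]

lemma matrix_inv_g: "z \<in> S \<Longrightarrow> matrix_inv (g z) *v (g z *v X) = X"
proof -
  assume z: "z \<in> S"
  have "X = 0" if "g z *v X = 0" for X
    using g_pos[OF z, of X] that by (auto simp: gform_def)
  then have "invertible (g z)"
    using matrix_left_invertible_ker invertible_left_inverse by blast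
  then show ?thesis
    by (simp add: matrix_vector_mul_assoc matrix_inv_mult_left)
qed

lemma christ_eq:
  assumes "z \<in> S"
  shows "christ g l i j z = \<Gamma> z (axis i 1) (axis j 1) $ l"
proof -
  let ?G = "\<Gamma> z (axis i 1) (axis j 1)"
  have "pd g i z $ j $ m + pd g j z $ i $ m - pd g m z $ i $ j = 2 * (g z *v ?G) $ m" for m
  proof -
    have "gform (g' z (axis i 1)) (axis j 1) (axis m 1) + gform (g' z (axis j 1)) (axis i 1) (axis m 1)
        - gform (g' z (axis m 1)) (axis i 1) (axis j 1) = 2 * gform (g z) ?G (axis m 1)"
      unfolding compatible[OF assms] torsion_free[OF assms, of _ "axis i 1"]
        torsion_free[OF assms, of "axis m 1"] g_commute[OF assms, of _ "\<Gamma> _ _ _"] by simp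
    then show ?thesis
      unfolding pd_eqI[OF g_deriv[OF assms]] gform_axis[symmetric] g_commute[OF assms, of ?G]
      by (simp add: gform_def inner_axis')
  qed
  then have "christ g l i j z = (matrix_inv (g z) *v (g z *v ?G)) $ l"
    by (simp add: christ_def matrix_vector_mult_def[of "matrix_inv _"] sum_distrib_left mult_ac)
  then show ?thesis by (simp add: matrix_inv_g[OF assms])
qed

lemma \<Gamma>'_unique:
  assumes "z \<in> S" "\<And>x. x \<in> S \<Longrightarrow> F x = \<Gamma> x X Y" "(F has_derivative F') (at z)"
  shows "\<Gamma>' z V X Y = F' V"
  using has_derivative_unique[OF \<Gamma>_deriv[OF assms(1)]
      has_derivative_transform_within_open[OF assms(3) open_S assms(1,2)]] by metis

lemma \<Gamma>'_sym: "z \<in> S \<Longrightarrow> \<Gamma>' z V X Y = \<Gamma>' z V Y X"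
  using \<Gamma>'_unique[OF _ torsion_free \<Gamma>_deriv] by blast

lemma \<Gamma>'_linear: "z \<in> S \<Longrightarrow> linear (\<Gamma>' z V X)"
proof (rule linearI)
  assume z: "z \<in> S"
  show "\<Gamma>' z V X (Y + Z) = \<Gamma>' z V X Y + \<Gamma>' z V X Z" for Y Z
    by (rule \<Gamma>'_unique[OF z _ has_derivative_add[OF \<Gamma>_deriv[OF z] \<Gamma>_deriv[OF z]]]) (simp add: \<Gamma>_add)
  show "\<Gamma>' z V X (r *\<^sub>R Y) = r *\<^sub>R \<Gamma>' z V X Y" for r Y
    by (rule \<Gamma>'_unique[OF z _ has_derivative_scaleR_right[OF \<Gamma>_deriv[OF z]]]) (simp add: \<Gamma>_scale)
qed

lemma \<Gamma>'_linear_direction: "z \<in> S \<Longrightarrow> linear (\<lambda>V. \<Gamma>' z V X Y)"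
  using \<Gamma>_deriv has_derivative_linear by blast

lemma curvature_linear:
  assumes z: "z \<in> S"
  shows "linear (\<lambda>X. connection_curvature (\<Gamma> z) (\<Gamma>' z) X Y Z)"
    and "linear (\<lambda>Y. connection_curvature (\<Gamma> z) (\<Gamma>' z) X Y Z)"
    and "linear (\<lambda>Z. connection_curvature (\<Gamma> z) (\<Gamma>' z) X Y Z)"
proof -
  have \<Gamma>_left: "\<Gamma> z (X + X') Y = \<Gamma> z X Y + \<Gamma> z X' Y" "\<Gamma> z (r *\<^sub>R X) Y = r *\<^sub>R \<Gamma> z X Y" for X X' Y r
    using torsion_free[OF z, of _ Y] \<Gamma>_add[OF z] \<Gamma>_scale[OF z] by simp_all
  have \<Gamma>'_middle: "\<Gamma>' z V (X + X') Y = \<Gamma>' z V X Y + \<Gamma>' z V X' Y"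
      "\<Gamma>' z V (r *\<^sub>R X) Y = r *\<^sub>R \<Gamma>' z V X Y" for V X X' Y r
    using \<Gamma>'_sym[OF z, of _ _ Y] linear_add[OF \<Gamma>'_linear[OF z]] linear_scale[OF \<Gamma>'_linear[OF z]] by simp_all
  note rules = \<Gamma>_left \<Gamma>'_middle \<Gamma>_add[OF z] \<Gamma>_scale[OF z]
    linear_add[OF \<Gamma>'_linear[OF z]] linear_scale[OF \<Gamma>'_linear[OF z]]
    linear_add[OF \<Gamma>'_linear_direction[OF z]] linear_scale[OF \<Gamma>'_linear_direction[OF z]]
  show "linear (\<lambda>X. connection_curvature (\<Gamma> z) (\<Gamma>' z) X Y Z)"
    and "linear (\<lambda>Y. connection_curvature (\<Gamma> z) (\<Gamma>' z) X Y Z)"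
    and "linear (\<lambda>Z. connection_curvature (\<Gamma> z) (\<Gamma>' z) X Y Z)"
    by (rule linearI; simp add: connection_curvature_def rules algebra_simps)+
qed

lemma riem_eq:
  assumes z: "z \<in> S"
  shows "riem g l i j k z = connection_curvature (\<Gamma> z) (\<Gamma>' z) (axis i 1) (axis j 1) (axis k 1) $ l"
proof -
  have pd: "pd (christ g l j k) i z = \<Gamma>' z (axis i 1) (axis j 1) (axis k 1) $ l" for i j k
  proof (rule pd_eqI, rule has_derivative_transform_within_open[OF _ open_S z])
    show "((\<lambda>z. \<Gamma> z (axis j 1) (axis k 1) $ l) has_derivative (\<lambda>V. \<Gamma>' z V (axis j 1) (axis k 1) $ l)) (at z)"
      by (rule bounded_linear.has_derivative[OF bounded_linear_vec_nth \<Gamma>_deriv[OF z]])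
  qed (simp add: christ_eq)
  have "(\<Sum>m\<in>UNIV. christ g m j k z * christ g l i m z)
      = (\<Sum>m\<in>UNIV. \<Gamma> z (axis j 1) (axis k 1) $ m *\<^sub>R \<Gamma> z (axis i 1) (axis m 1)) $ l" for i j
    by (simp add: christ_eq[OF z])
  moreover have "(\<Sum>m\<in>UNIV. \<Gamma> z (axis j 1) (axis k 1) $ m *\<^sub>R \<Gamma> z (axis i 1) (axis m 1)) $ l
      = \<Gamma> z (axis i 1) (\<Gamma> z (axis j 1) (axis k 1)) $ l" for i j
    unfolding linear_axis_expansion[OF \<Gamma>_linear[OF z]] ..
  ultimately show ?thesis
    by (simp add: riem_def pd sum_subtractf connection_curvature_def)
qed

theorem riem_vec_eq:
  assumes z: "z \<in> S"
  shows "riem_vec g z X Y Z = connection_curvature (\<Gamma> z) (\<Gamma>' z) X Y Z"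
proof -
  let ?R = "connection_curvature (\<Gamma> z) (\<Gamma>' z)"
  have "riem_vec g z X Y Z $ l = (\<Sum>i\<in>UNIV. X $ i *\<^sub>R (\<Sum>j\<in>UNIV. Y $ j *\<^sub>R (\<Sum>k\<in>UNIV. Z $ k *\<^sub>R
      ?R (axis i 1) (axis j 1) (axis k 1)))) $ l" for l
    by (simp add: riem_vec_def riem_eq[OF z] sum_distrib_left mult.assoc)
  then show ?thesis
    by (simp add: vec_eq_iff curvature_linear[OF z, THEN linear_axis_expansion])
qed

lemma riem_vec_linear: "z \<in> S \<Longrightarrow> linear (\<lambda>X. riem_vec g z X Y Z)"
  by (simp add: riem_vec_eq curvature_linear(1))

theorem ricci_eq:
  assumes "z \<in> S"
  shows "ricci g i j z = trace (matrix (\<lambda>X. riem_vec g z X (axis i 1) (axis j 1)))"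
  by (simp add: ricci_def riem_eq[OF assms] riem_vec_eq[OF assms] trace_matrix)

end

text \<open>The metric \<open>\<phi>\<^sup>2 h\<close>, where \<open>T\<close> is the gradient of \<open>ln \<phi>\<close> with respect to \<open>h\<close>.\<close>
locale conformal_change = levi_civita S h h' \<Gamma> \<Gamma>'
  for S :: "(real^('m::finite)) set" and h h' \<Gamma> \<Gamma>' +
  fixes \<phi> :: "real^'m \<Rightarrow> real" and T :: "real^'m \<Rightarrow> real^'m" and T' :: "real^'m \<Rightarrow> real^'m \<Rightarrow> real^'m"
  assumes \<phi>_nonzero: "z \<in> S \<Longrightarrow> \<phi> z \<noteq> 0"
    and \<phi>_deriv: "z \<in> S \<Longrightarrow> (\<phi> has_derivative (\<lambda>V. \<phi> z * gform (h z) (T z) V)) (at z)"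
    and T_deriv: "z \<in> S \<Longrightarrow> (T has_derivative T' z) (at z)"
    and hessian_sym: "z \<in> S \<Longrightarrow>
      gform (h z) (T' z V + \<Gamma> z V (T z)) W = gform (h z) (T' z W + \<Gamma> z W (T z)) V"
begin

definition conformal_\<Gamma> :: "real^'m \<Rightarrow> real^'m \<Rightarrow> real^'m \<Rightarrow> real^'m" where
  "conformal_\<Gamma> z X Y = \<Gamma> z X Y + gform (h z) (T z) X *\<^sub>R Y + gform (h z) (T z) Y *\<^sub>R X
     - gform (h z) X Y *\<^sub>R T z"

definition conformal_\<Gamma>' :: "real^'m \<Rightarrow> real^'m \<Rightarrow> real^'m \<Rightarrow> real^'m \<Rightarrow> real^'m" where
  "conformal_\<Gamma>' z V X Y = \<Gamma>' z V X Y
     + (gform (h' z V) (T z) X + gform (h z) (T' z V) X) *\<^sub>R Y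
     + (gform (h' z V) (T z) Y + gform (h z) (T' z V) Y) *\<^sub>R X
     - gform (h' z V) X Y *\<^sub>R T z - gform (h z) X Y *\<^sub>R T' z V"

definition schouten_change :: "real^'m \<Rightarrow> real^'m \<Rightarrow> real^'m" where
  "schouten_change z V = T' z V + \<Gamma> z V (T z) - gform (h z) (T z) V *\<^sub>R T z
     + (gform (h z) (T z) (T z) / 2) *\<^sub>R V"

lemma gform_has_derivative:
  assumes "z \<in> S" "(F has_derivative F') (at z)"
  shows "((\<lambda>z. gform (h z) (F z) Y) has_derivative (\<lambda>V. gform (h' z V) (F z) Y + gform (h z) (F' V) Y)) (at z)"
proof -
  have "((\<lambda>z. F z \<bullet> (h z *v Y)) has_derivative (\<lambda>V. F z \<bullet> (h' z V *v Y) + F' V \<bullet> (h z *v Y))) (at z)"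
    using bounded_bilinear.FDERIV[OF bounded_bilinear_matrix_vector_mult g_deriv[OF assms(1)]
        has_derivative_const]
    by (intro has_derivative_inner assms(2)) simp
  then show ?thesis by (simp add: gform_def)
qed

lemma levi_civita_conformal:
  "levi_civita S (\<lambda>z. (\<phi> z)\<^sup>2 *\<^sub>R h z)
     (\<lambda>z V. (\<phi> z)\<^sup>2 *\<^sub>R (h' z V + (2 * gform (h z) (T z) V) *\<^sub>R h z)) conformal_\<Gamma> conformal_\<Gamma>'"
proof (rule levi_civita.intro)
  fix z assume z: "z \<in> S"
  note rules = gform_linear_simps gform_matrix_simps
  show "((\<lambda>z. (\<phi> z)\<^sup>2 *\<^sub>R h z) has_derivative
      (\<lambda>V. (\<phi> z)\<^sup>2 *\<^sub>R (h' z V + (2 * gform (h z) (T z) V) *\<^sub>R h z))) (at z)"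
    by (auto intro!: derivative_eq_intros g_deriv[OF z] \<phi>_deriv[OF z] simp: algebra_simps power2_eq_square)
  show "transpose ((\<phi> z)\<^sup>2 *\<^sub>R h z) = (\<phi> z)\<^sup>2 *\<^sub>R h z"
    using g_sym[OF z] by (simp add: vec_eq_iff transpose_def)
  show "gform ((\<phi> z)\<^sup>2 *\<^sub>R h z) X X > 0" if "X \<noteq> 0" for X
    using g_pos[OF z that] \<phi>_nonzero[OF z] by (simp add: rules)
  show "((\<lambda>z. conformal_\<Gamma> z X Y) has_derivative (\<lambda>V. conformal_\<Gamma>' z V X Y)) (at z)" for X Y
    unfolding conformal_\<Gamma>_def conformal_\<Gamma>'_def
    by (rule derivative_eq_intros \<Gamma>_deriv[OF z] T_deriv[OF z] gform_has_derivative[OF z] refl)+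
      (simp add: gform_linear_simps algebra_simps)
  show "linear (conformal_\<Gamma> z X)" for X
    by (rule linearI) (simp_all add: conformal_\<Gamma>_def rules \<Gamma>_add[OF z] \<Gamma>_scale[OF z] algebra_simps)
  show "conformal_\<Gamma> z X Y = conformal_\<Gamma> z Y X" for X Y
    using torsion_free[OF z, of X Y] g_commute[OF z, of X Y] by (simp add: conformal_\<Gamma>_def)
  show "gform ((\<phi> z)\<^sup>2 *\<^sub>R (h' z V + (2 * gform (h z) (T z) V) *\<^sub>R h z)) X Y
      = gform ((\<phi> z)\<^sup>2 *\<^sub>R h z) (conformal_\<Gamma> z V X) Y + gform ((\<phi> z)\<^sup>2 *\<^sub>R h z) X (conformal_\<Gamma> z V Y)" for V X Y
    unfolding conformal_\<Gamma>_def rules compatible[OF z] g_commute[OF z, of X "T z"] g_commute[OF z, of X V]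
    by (simp add: algebra_simps)
qed (rule open_S)

text \<open>With \<open>\<theta> = d ln \<phi>\<close>, the tensor \<open>schouten_change\<close> represents \<open>\<nabla>\<theta> - \<theta> \<otimes> \<theta> + |\<theta>|\<^sup>2 h / 2\<close>.\<close>
theorem curvature_conformal:
  assumes z: "z \<in> S"
  shows "connection_curvature (conformal_\<Gamma> z) (conformal_\<Gamma>' z) X Y Z =
     connection_curvature (\<Gamma> z) (\<Gamma>' z) X Y Z - kulkarni_nomizu (gform (h z)) (schouten_change z) X Y Z"
proof -
  have hess: "gform (h z) (T' z X) Y + gform (h z) (\<Gamma> z X (T z)) Y
      = gform (h z) (T' z Y) X + gform (h z) (\<Gamma> z Y (T z)) X"
    using hessian_sym[OF z, of X Y] by (simp add: gform_linear_simps)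
  note rules = gform_linear_simps compatible[OF z] \<Gamma>_add[OF z] \<Gamma>_scale[OF z] linear_diff[OF \<Gamma>_linear[OF z]]
  have "connection_curvature (conformal_\<Gamma> z) (conformal_\<Gamma>' z) X Y Z $ i =
     (connection_curvature (\<Gamma> z) (\<Gamma>' z) X Y Z - kulkarni_nomizu (gform (h z)) (schouten_change z) X Y Z) $ i"
    for i
    using hess
    unfolding connection_curvature_def kulkarni_nomizu_def conformal_\<Gamma>_def conformal_\<Gamma>'_def
      schouten_change_def rules
    by (simp add: torsion_free[OF z] g_commute[OF z]) algebra
  then show ?thesis by (simp add: vec_eq_iff)
qed

end

section \<open>Curvature tensors of metrics squashed along the Hopf fibres\<close>

text \<open>The polarized algebraic curvature tensor of the two-forms \<open>h (A X) Y\<close> and \<open>h (B X) Y\<close>.\<close>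
definition two_form_curvature ::
    "('a::real_vector \<Rightarrow> 'a \<Rightarrow> real) \<Rightarrow> ('a \<Rightarrow> 'a) \<Rightarrow> ('a \<Rightarrow> 'a) \<Rightarrow> 'a \<Rightarrow> 'a \<Rightarrow> 'a \<Rightarrow> 'a" where
  "two_form_curvature h A B X Y Z =
     (2 * h (A X) Y) *\<^sub>R B Z + h (A X) Z *\<^sub>R B Y - h (A Y) Z *\<^sub>R B X"

text \<open>Here \<open>\<Omega>\<close> is a Kaehler form raised with \<open>h\<close>, and \<open>\<pi>\<close> maps onto a complex line, up to scale. The
  factor \<open>2 / 3\<close> makes \<open>c''\<close> the coefficient of \<open>-2 (h (\<Omega> (\<pi> X)) Y)\<^sup>2\<close> in the sectional curvature.\<close>
definition hopf_curvature ::
    "('a::real_vector \<Rightarrow> 'a \<Rightarrow> real) \<Rightarrow> ('a \<Rightarrow> 'a) \<Rightarrow> ('a \<Rightarrow> 'a) \<Rightarrow> real \<Rightarrow> real \<Rightarrow> real \<Rightarrow> real \<Rightarrow> real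
      \<Rightarrow> 'a \<Rightarrow> 'a \<Rightarrow> 'a \<Rightarrow> 'a" where
  "hopf_curvature h \<Omega> \<pi> r s c c' c'' X Y Z =
     c *\<^sub>R two_form_curvature h \<Omega> \<Omega> X Y Z
     + c' *\<^sub>R (two_form_curvature h \<Omega> (\<lambda>V. \<Omega> (\<pi> V)) X Y Z + two_form_curvature h (\<lambda>V. \<Omega> (\<pi> V)) \<Omega> X Y Z)
     + (2 / 3 * c'') *\<^sub>R two_form_curvature h (\<lambda>V. \<Omega> (\<pi> V)) (\<lambda>V. \<Omega> (\<pi> V)) X Y Z
     - kulkarni_nomizu h (\<lambda>V. (r / 2) *\<^sub>R V + s *\<^sub>R \<pi> V) X Y Z"

lemma hopf_curvature_transfer:
  assumes "linear A" "\<And>X Y. h X Y = A X \<bullet> A Y" "\<And>X. A (\<Omega> X) = \<Omega>' (A X)" "\<And>X. A (\<pi> X) = \<pi>' (A X)"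
  shows "A (hopf_curvature h \<Omega> \<pi> r s c c' c'' X Y Z)
    = hopf_curvature (\<bullet>) \<Omega>' \<pi>' r s c c' c'' (A X) (A Y) (A Z)"
  by (simp add: hopf_curvature_def two_form_curvature_def kulkarni_nomizu_def assms(2-4)
      linear_add[OF assms(1)] linear_diff[OF assms(1)] linear_scale[OF assms(1)])

lemma trace_kulkarni_nomizu:
  fixes P :: "real^'m \<Rightarrow> real^'m"
  assumes "linear P" "\<And>X Y. P X \<bullet> Y = X \<bullet> P Y"
  shows "trace (matrix (\<lambda>X. kulkarni_nomizu (\<bullet>) P X Y Z))
    = (real CARD('m) - 2) * (P Y \<bullet> Z) + trace (matrix P) * (Y \<bullet> Z)"
proof -
  have functional: "linear (\<lambda>X. P X \<bullet> Z)" "linear (\<lambda>X. X \<bullet> Z)"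
    by (auto intro!: linearI simp: linear_add[OF assms(1)] linear_scale[OF assms(1)] inner_simps)
  show ?thesis
    unfolding kulkarni_nomizu_def trace_matrix_simps functional[THEN trace_matrix_functional]
    by (simp add: assms(2)[of Y Z] algebra_simps)
qed

lemma trace_two_form_curvature:
  fixes A B :: "real^'m \<Rightarrow> real^'m"
  assumes "linear A" "\<And>X Y. A X \<bullet> Y = - (X \<bullet> A Y)" "\<And>X Y. B X \<bullet> Y = - (X \<bullet> B Y)"
  shows "trace (matrix (\<lambda>X. two_form_curvature (\<bullet>) A B X Y Z)) = - 2 * (B Z \<bullet> A Y) - B Y \<bullet> A Z"
proof -
  have functional: "linear (\<lambda>X. 2 * (A X \<bullet> Y))" "linear (\<lambda>X. A X \<bullet> Z)"
    by (auto intro!: linearI simp: linear_add[OF assms(1)] linear_scale[OF assms(1)] inner_simps algebra_simps)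
  have "B X \<bullet> X = 0" for X using assms(3)[of X X] by (simp add: inner_commute)
  then have "trace (matrix B) = 0" by (rule trace_matrix_skew)
  then show ?thesis
    unfolding two_form_curvature_def trace_matrix_simps functional[THEN trace_matrix_functional]
    by (simp add: assms(2))
qed

locale complex_structure =
  fixes J :: "real^'m^'m"
  assumes J_mult_J: "J ** J = - mat 1" and J_orthogonal: "transpose J ** J = mat 1"
begin

lemma J_J [simp]: "J *v (J *v x) = - x"
proof -
  have "J *v (J *v x) = (- mat 1) *v x" by (simp add: matrix_vector_mul_assoc J_mult_J)
  also have "\<dots> = (0 - mat 1) *v x" by simp
  also have "\<dots> = - x" unfolding matrix_vector_mult_diff_rdistrib by simp
  finally show ?thesis .
qed

lemma J_inner_J [simp]: "(J *v x) \<bullet> (J *v y) = x \<bullet> y"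
  by (metis J_orthogonal dot_lmul_matrix matrix_vector_mul_assoc matrix_vector_mul_lid transpose_matrix_vector)

lemma inner_J_right: "x \<bullet> (J *v y) = - ((J *v x) \<bullet> y)"
  using J_inner_J[of x "J *v y"] by simp

lemma J_inner_commute: "(J *v x) \<bullet> y = - ((J *v y) \<bullet> x)"
  using inner_J_right[of y x] by (simp add: inner_commute)

lemma J_inner_self [simp]: "(J *v x) \<bullet> x = 0" "x \<bullet> (J *v x) = 0"
  using J_inner_commute[of x x] by (simp_all add: inner_J_right)

lemmas inner_distribs = inner_simps inner_minus_left inner_minus_right matrix_vector_right_distrib
  matrix_vector_mult_scaleR matrix_vector_mult_diff_distrib J_J J_inner_J inner_J_right J_inner_self

lemma inner_normalize:
  "X \<bullet> z = z \<bullet> X \<and> Y \<bullet> z = z \<bullet> Y \<and> Z \<bullet> z = z \<bullet> Z \<and> U \<bullet> z = z \<bullet> U \<and>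
   Y \<bullet> X = X \<bullet> Y \<and> Z \<bullet> X = X \<bullet> Z \<and> U \<bullet> X = X \<bullet> U \<and> Z \<bullet> Y = Y \<bullet> Z \<and>
   U \<bullet> Y = Y \<bullet> U \<and> U \<bullet> Z = Z \<bullet> U \<and> (J *v X) \<bullet> z = - ((J *v z) \<bullet> X) \<and>
   (J *v Y) \<bullet> z = - ((J *v z) \<bullet> Y) \<and> (J *v Z) \<bullet> z = - ((J *v z) \<bullet> Z) \<and>
   (J *v U) \<bullet> z = - ((J *v z) \<bullet> U) \<and> (J *v Y) \<bullet> X = - ((J *v X) \<bullet> Y) \<and>
   (J *v Z) \<bullet> X = - ((J *v X) \<bullet> Z) \<and> (J *v U) \<bullet> X = - ((J *v X) \<bullet> U) \<and>
   (J *v Z) \<bullet> Y = - ((J *v Y) \<bullet> Z) \<and> (J *v U) \<bullet> Y = - ((J *v Y) \<bullet> U) \<and>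
   (J *v U) \<bullet> Z = - ((J *v Z) \<bullet> U)"
  by (intro conjI inner_commute J_inner_commute)

text \<open>The square of \<open>norm z\<close> times the orthogonal projection onto the complex line through \<open>z\<close>.\<close>
definition complex_line :: "real^'m \<Rightarrow> real^'m \<Rightarrow> real^'m" where
  "complex_line z V = (z \<bullet> V) *\<^sub>R z + ((J *v z) \<bullet> V) *\<^sub>R (J *v z)"

lemma linear_complex_line: "linear (complex_line z)"
  by (rule linearI) (simp_all add: complex_line_def inner_simps algebra_simps)

lemma complex_line_inner: "complex_line z X \<bullet> Y = X \<bullet> complex_line z Y"
  by (simp add: complex_line_def inner_simps inner_commute)

lemma J_complex_line: "J *v complex_line z X = complex_line z (J *v X)"
  by (simp add: complex_line_def matrix_vector_right_distrib matrix_vector_mult_scaleR inner_J_right)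

lemma complex_line_complex_line: "complex_line z (complex_line z X) = (z \<bullet> z) *\<^sub>R complex_line z X"
  by (simp add: complex_line_def inner_simps inner_J_right algebra_simps)

lemma trace_complex_line: "trace (matrix (complex_line z)) = 2 * (z \<bullet> z)"
proof -
  have functional: "linear (\<lambda>V. z \<bullet> V)" "linear (\<lambda>V. (J *v z) \<bullet> V)"
    by (auto intro!: linearI simp: inner_simps)
  show ?thesis
    unfolding complex_line_def trace_matrix_simps functional[THEN trace_matrix_functional] by simp
qed

lemma trace_hopf_curvature:
  "trace (matrix (\<lambda>X. hopf_curvature (\<bullet>) ((*v) J) (complex_line z) r s c c' c'' X Y Z))
    = - ((real CARD('m) - 1) * r + 2 * (z \<bullet> z) * s + 3 * c) * (Y \<bullet> Z)
      - ((real CARD('m) - 2) * s + 6 * c' + 2 * (z \<bullet> z) * c'') * (complex_line z Y \<bullet> Z)"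
proof -
  let ?P = "\<lambda>V. (r / 2) *\<^sub>R V + s *\<^sub>R complex_line z V" and ?D = "\<lambda>V. J *v complex_line z V"
  have P: "linear ?P" "\<And>X Y. ?P X \<bullet> Y = X \<bullet> ?P Y"
    by (auto intro!: linearI simp: linear_add[OF linear_complex_line] linear_scale[OF linear_complex_line]
        inner_simps complex_line_inner algebra_simps)
  have J: "(J *v X) \<bullet> Y = - (X \<bullet> (J *v Y))" for X Y by (simp add: inner_J_right)
  have D: "linear ?D" "?D X \<bullet> Y = - (X \<bullet> ?D Y)" for X Y
    using linear_compose[OF linear_complex_line matrix_vector_mul_linear[of J]]
    by (simp_all add: o_def J complex_line_inner J_complex_line)
  have products: "?D X \<bullet> (J *v Y) = complex_line z X \<bullet> Y" "(J *v X) \<bullet> ?D Y = complex_line z X \<bullet> Y"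
      "?D X \<bullet> ?D Y = (z \<bullet> z) * (complex_line z X \<bullet> Y)" for X Y
    by (simp_all add: complex_line_inner complex_line_complex_line)
  note J_skew = trace_two_form_curvature[OF matrix_vector_mul_linear[of J] J]
    and D_skew = trace_two_form_curvature[OF D]
  show ?thesis
    unfolding hopf_curvature_def trace_matrix_simps trace_kulkarni_nomizu[OF P] trace_complex_line
      J_skew[OF J] J_skew[OF D(2)] D_skew[OF J] D_skew[OF D(2)] products
    by (simp add: inner_simps complex_line_inner inner_commute[of Z]
        complex_line_complex_line field_simps)
qed

definition squash :: "real \<Rightarrow> real \<Rightarrow> real^'m \<Rightarrow> real^'m^'m" where
  "squash p q z = mat 1 + p *\<^sub>R outer z z + q *\<^sub>R outer (J *v z) (J *v z)"

lemma squash_mult_vector: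
  "squash p q z *v X = X + (p * (z \<bullet> X)) *\<^sub>R z + (q * ((J *v z) \<bullet> X)) *\<^sub>R (J *v z)"
  by (simp add: squash_def matrix_vector_mult_add_rdistrib scaleR_matrix_vector_assoc[symmetric]
      outer_mult_vector)

lemma gform_squash:
  "gform (squash p q z) X Y = X \<bullet> Y + p * (z \<bullet> X) * (z \<bullet> Y) + q * ((J *v z) \<bullet> X) * ((J *v z) \<bullet> Y)"
  by (simp add: squash_def gform_matrix_simps)

lemma transpose_squash: "transpose (squash p q z) = squash p q z"
  by (simp add: squash_def vec_eq_iff transpose_def outer_def mat_def mult.commute eq_commute)

lemma squash_mult_squash:
  "squash p q z ** squash p' q' z = squash (p + p' + p * p' * (z \<bullet> z)) (q + q' + q * q' * (z \<bullet> z)) z"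
  by (simp add: matrix_eq matrix_vector_mul_assoc[symmetric] squash_mult_vector inner_simps inner_J_right
      algebra_simps)

lemma squash_0 [simp]: "squash 0 0 z = mat 1"
  by (simp add: squash_def)

lemma inner_squash_left: "(squash p q z *v X) \<bullet> Y = gform (squash p q z) X Y"
  by (simp add: gform_squash squash_mult_vector inner_simps inner_commute)

lemma inner_squash_axes:
  "z \<bullet> (squash p q z *v X) = (1 + p * (z \<bullet> z)) * (z \<bullet> X)"
  "(J *v z) \<bullet> (squash p q z *v X) = (1 + q * (z \<bullet> z)) * ((J *v z) \<bullet> X)"
  by (simp_all add: squash_mult_vector inner_simps inner_J_right algebra_simps)

lemma squash_complex_line: "squash p q z *v complex_line z X = complex_line z (squash p q z *v X)"
  unfolding complex_line_def inner_squash_axes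
  by (simp add: squash_mult_vector inner_simps inner_J_right algebra_simps)

text \<open>The hypothesis says that \<open>squash p q z\<close> has determinant one on the complex line through \<open>z\<close>, so that
  it is symplectic.\<close>
lemma squash_symplectic:
  assumes "p + q + p * q * (z \<bullet> z) = 0"
  shows "(J *v (squash p q z *v X)) \<bullet> (squash p q z *v Y) = (J *v X) \<bullet> Y"
proof -
  have "(J *v (squash p q z *v X)) \<bullet> (squash p q z *v Y) = (J *v X) \<bullet> Y
     + ((z \<bullet> X) * ((J *v z) \<bullet> Y) - (z \<bullet> Y) * ((J *v z) \<bullet> X)) * (p + q + p * q * (z \<bullet> z))"
    using J_inner_commute[of X z] J_inner_commute[of Y z]
    by (simp add: squash_mult_vector matrix_vector_right_distrib matrix_vector_mult_scaleR inner_simps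
        inner_J_right inner_commute[of X z] inner_commute[of "J *v X" "J *v z"] algebra_simps)
  then show ?thesis using assms by simp
qed

end

locale squashed_metric = complex_structure J for J :: "real^'m^'m" +
  fixes c c' c'' :: "real \<Rightarrow> real"
  assumes c_deriv: "(c has_real_derivative c' t) (at t)"
    and c'_deriv: "(c' has_real_derivative c'' t) (at t)"
    and factor_pos: "t \<in> {0..1} \<Longrightarrow> 1 + t * c t > 0"
begin

definition u :: "real \<Rightarrow> real" where "u t = 1 + t * c t"
definition u' :: "real \<Rightarrow> real" where "u' t = c t + t * c' t"
definition e :: "real \<Rightarrow> real" where "e t = (c' t - (c t)\<^sup>2) / u t"
definition e' :: "real \<Rightarrow> real" where "e' t = (c'' t - 2 * c t * c' t - u' t * e t) / u t"

definition h :: "'m mfield" where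
  "h z = squash (- c (z \<bullet> z) / u (z \<bullet> z)) (c (z \<bullet> z)) z"

definition h' :: "real^'m \<Rightarrow> real^'m \<Rightarrow> real^'m^'m" where
  "h' z V = (2 * (z \<bullet> V)) *\<^sub>R
      ((- e (z \<bullet> z) / u (z \<bullet> z)) *\<^sub>R outer z z + c' (z \<bullet> z) *\<^sub>R outer (J *v z) (J *v z))
    + (- c (z \<bullet> z) / u (z \<bullet> z)) *\<^sub>R (outer V z + outer z V)
    + c (z \<bullet> z) *\<^sub>R (outer (J *v V) (J *v z) + outer (J *v z) (J *v V))"

definition \<Gamma> :: "real^'m \<Rightarrow> real^'m \<Rightarrow> real^'m \<Rightarrow> real^'m" where
  "\<Gamma> z X Y = (let t = z \<bullet> z; w = J *v z in
     c t *\<^sub>R ((w \<bullet> Y) *\<^sub>R (J *v X) + (w \<bullet> X) *\<^sub>R (J *v Y))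
     - (c t * (X \<bullet> Y) + e t * (z \<bullet> X) * (z \<bullet> Y) + (2 * (c t)\<^sup>2 + u t * c' t) * (w \<bullet> X) * (w \<bullet> Y)) *\<^sub>R z
     + (e t * ((z \<bullet> X) * (w \<bullet> Y) + (w \<bullet> X) * (z \<bullet> Y))) *\<^sub>R w)"

definition \<Gamma>' :: "real^'m \<Rightarrow> real^'m \<Rightarrow> real^'m \<Rightarrow> real^'m \<Rightarrow> real^'m" where
  "\<Gamma>' z V X Y = (let t = z \<bullet> z; w = J *v z; v = J *v V; d = 2 * (c t)\<^sup>2 + u t * c' t in
     (2 * (z \<bullet> V)) *\<^sub>R (c' t *\<^sub>R ((w \<bullet> Y) *\<^sub>R (J *v X) + (w \<bullet> X) *\<^sub>R (J *v Y))
       - (c' t * (X \<bullet> Y) + e' t * (z \<bullet> X) * (z \<bullet> Y)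
          + (4 * c t * c' t + u' t * c' t + u t * c'' t) * (w \<bullet> X) * (w \<bullet> Y)) *\<^sub>R z
       + (e' t * ((z \<bullet> X) * (w \<bullet> Y) + (w \<bullet> X) * (z \<bullet> Y))) *\<^sub>R w)
     + c t *\<^sub>R ((v \<bullet> Y) *\<^sub>R (J *v X) + (v \<bullet> X) *\<^sub>R (J *v Y))
     - (e t * ((V \<bullet> X) * (z \<bullet> Y) + (z \<bullet> X) * (V \<bullet> Y)) + d * ((v \<bullet> X) * (w \<bullet> Y) + (w \<bullet> X) * (v \<bullet> Y))) *\<^sub>R z
     - (c t * (X \<bullet> Y) + e t * (z \<bullet> X) * (z \<bullet> Y) + d * (w \<bullet> X) * (w \<bullet> Y)) *\<^sub>R V
     + (e t * ((V \<bullet> X) * (w \<bullet> Y) + (z \<bullet> X) * (v \<bullet> Y) + (v \<bullet> X) * (z \<bullet> Y) + (w \<bullet> X) * (V \<bullet> Y))) *\<^sub>R w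
     + (e t * ((z \<bullet> X) * (w \<bullet> Y) + (w \<bullet> X) * (z \<bullet> Y))) *\<^sub>R v)"

text \<open>The Kaehler form \<open>(J X) \<bullet> Y\<close>, raised with \<open>h\<close>.\<close>
definition \<Omega> :: "real^'m \<Rightarrow> real^'m \<Rightarrow> real^'m" where
  "\<Omega> z V = J *v V - (c (z \<bullet> z) * ((J *v z) \<bullet> V)) *\<^sub>R z
     - (c (z \<bullet> z) / u (z \<bullet> z) * (z \<bullet> V)) *\<^sub>R (J *v z)"

lemma u_pos: "t \<in> {0..1} \<Longrightarrow> u t > 0"
  using factor_pos by (simp add: u_def)

lemma u_nonzero: "t \<in> {0..1} \<Longrightarrow> u t \<noteq> 0"
  using u_pos by fastforce

lemma u_mult_e: "t \<in> {0..1} \<Longrightarrow> u t * e t = c' t - (c t)\<^sup>2"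
  using u_nonzero by (simp add: e_def)

lemma u_mult_e': "t \<in> {0..1} \<Longrightarrow> u t * e' t = c'' t - 2 * c t * c' t - u' t * e t"
  using u_nonzero by (simp add: e'_def)

lemma u_mult_c_plus_e:
  assumes "t \<in> {0..1}"
  shows "u t * (c t + t * e t) = u' t"
proof -
  have "u t * (c t + t * e t) = u t * c t + t * (u t * e t)" by (simp add: algebra_simps)
  then show ?thesis
    unfolding u_mult_e[OF assms] by (simp add: u_def u'_def algebra_simps power2_eq_square)
qed

lemma one_minus_c_div_u: "t \<in> {0..1} \<Longrightarrow> 1 - c t / u t * t = 1 / u t"
  using u_nonzero by (simp add: field_simps) (simp add: u_def)

lemma gform_h: "gform (h z) X Y = X \<bullet> Y - c (z \<bullet> z) / u (z \<bullet> z) * (z \<bullet> X) * (z \<bullet> Y)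
    + c (z \<bullet> z) * ((J *v z) \<bullet> X) * ((J *v z) \<bullet> Y)"
  by (simp add: h_def gform_squash)

context
  fixes z :: "real^'m"
  assumes z: "z \<bullet> z \<in> {0..1}"
begin

lemma gform_h_radial: "gform (h z) z X = (z \<bullet> X) / u (z \<bullet> z)"
proof -
  have "gform (h z) z X = (1 - c (z \<bullet> z) / u (z \<bullet> z) * (z \<bullet> z)) * (z \<bullet> X)"
    by (simp add: gform_h algebra_simps)
  then show ?thesis unfolding one_minus_c_div_u[OF z] by simp
qed

lemma gform_h_fibre: "gform (h z) (J *v z) X = u (z \<bullet> z) * ((J *v z) \<bullet> X)"
  by (simp add: gform_h u_def algebra_simps)

lemma gform_h_complex_line:
  "gform (h z) (complex_line z X) Y
    = (z \<bullet> X) * (z \<bullet> Y) / u (z \<bullet> z) + u (z \<bullet> z) * ((J *v z) \<bullet> X) * ((J *v z) \<bullet> Y)"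
  by (simp add: complex_line_def gform_linear_simps gform_h_radial gform_h_fibre)

lemma gform_h_J: "gform (h z) (J *v X) Y = (J *v X) \<bullet> Y
    + c (z \<bullet> z) / u (z \<bullet> z) * ((J *v z) \<bullet> X) * (z \<bullet> Y) + c (z \<bullet> z) * (z \<bullet> X) * ((J *v z) \<bullet> Y)"
  by (simp add: gform_h inner_J_right)

lemma gform_h_\<Omega>: "gform (h z) (\<Omega> z X) Y = (J *v X) \<bullet> Y"
  unfolding \<Omega>_def gform_linear_simps gform_h_radial gform_h_fibre
  unfolding gform_h_J using u_nonzero[OF z] by simp

lemma \<Omega>_complex_line:
  "\<Omega> z (complex_line z X) = ((z \<bullet> X) / u (z \<bullet> z)) *\<^sub>R (J *v z) - (u (z \<bullet> z) * ((J *v z) \<bullet> X)) *\<^sub>R z"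
proof -
  define t where "t = z \<bullet> z"
  have "\<Omega> z (complex_line z X) = ((1 - c t / u t * t) * (z \<bullet> X)) *\<^sub>R (J *v z) - (u t * ((J *v z) \<bullet> X)) *\<^sub>R z"
    unfolding \<Omega>_def complex_line_def t_def[symmetric]
    by (simp add: inner_simps inner_J_right t_def[symmetric] u_def algebra_simps
        matrix_vector_right_distrib matrix_vector_mult_scaleR)
  then show ?thesis unfolding t_def one_minus_c_div_u[OF z] by simp
qed

end

text \<open>The common expanded form of both sides of \<open>curvature_h\<close> below. Both expansions are polynomial identities
  because no quotient by \<open>u\<close> occurs in it.\<close>
definition squashed_curvature :: "real^'m \<Rightarrow> real^'m \<Rightarrow> real^'m \<Rightarrow> real^'m \<Rightarrow> real^'m" where
  "squashed_curvature z X Y Z = (let t = z \<bullet> z; w = J *v z; q = (c t)\<^sup>2 + u t * c' t;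
       A = \<lambda>X Y. c t * (X \<bullet> Y) + e t * (z \<bullet> X) * (z \<bullet> Y) + q * (w \<bullet> X) * (w \<bullet> Y);
       D = \<lambda>X Y. (z \<bullet> X) * (w \<bullet> Y) - (w \<bullet> X) * (z \<bullet> Y);
       B = \<lambda>X Y. c t * ((J *v X) \<bullet> Y) + c' t * D X Y;
       K = \<lambda>v. 2 * ((J *v X) \<bullet> Y) * (v \<bullet> Z) + ((J *v X) \<bullet> Z) * (v \<bullet> Y) - ((J *v Y) \<bullet> Z) * (v \<bullet> X) in
     A X Z *\<^sub>R Y - A Y Z *\<^sub>R X + B X Z *\<^sub>R (J *v Y) - B Y Z *\<^sub>R (J *v X) + (2 * B X Y) *\<^sub>R (J *v Z)
     + (c' t * ((X \<bullet> Z) * (z \<bullet> Y) - (Y \<bullet> Z) * (z \<bullet> X)) - q * K w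
         - (4 * c t * c' t + 2 * u t * c'' t) * D X Y * (w \<bullet> Z)) *\<^sub>R z
     + (c' t * ((X \<bullet> Z) * (w \<bullet> Y) - (Y \<bullet> Z) * (w \<bullet> X)) + e t * K z
         + 2 * (e' t + e t * (c t + t * e t)) * D X Y * (z \<bullet> Z)) *\<^sub>R w)"

lemma connection_curvature_\<Gamma>:
  assumes z: "z \<bullet> z \<in> {0..1}"
  shows "connection_curvature (\<Gamma> z) (\<Gamma>' z) X Y Z = squashed_curvature z X Y Z"
proof -
  define t where "t = z \<bullet> z"
  note t = z[folded t_def]
  have u: "u t = 1 + t * c t" and u': "u' t = c t + t * c' t"
    by (simp_all add: u_def u'_def)
  have c': "c' t = u t * e t + (c t)\<^sup>2" and c'': "c'' t = u' t * e t + u t * e' t + 2 * c t * c' t"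
    using u_mult_e[OF t] u_mult_e'[OF t] by linarith+
  have "connection_curvature (\<Gamma> z) (\<Gamma>' z) X Y Z \<bullet> U = squashed_curvature z X Y Z \<bullet> U" for U
    unfolding connection_curvature_def squashed_curvature_def \<Gamma>_def \<Gamma>'_def Let_def t_def[symmetric]
    unfolding c'' u' c' u
    by (simp only: inner_distribs inner_normalize[of X z Y Z U] t_def[symmetric]) algebra
  then show ?thesis using vector_eq_rdot by blast
qed

lemma hopf_curvature_h:
  assumes z: "z \<bullet> z \<in> {0..1}"
  shows "hopf_curvature (gform (h z)) (\<Omega> z) (complex_line z)
      (c (z \<bullet> z)) (c' (z \<bullet> z)) (c (z \<bullet> z)) (c' (z \<bullet> z)) (c'' (z \<bullet> z)) X Y Z = squashed_curvature z X Y Z"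
proof -
  define t i where "t = z \<bullet> z" and "i = 1 / u t"
  note t = z[folded t_def]
  have quotient: "x / u t = x * i" for x by (simp add: i_def)
  have e: "e t = (c' t - (c t)\<^sup>2) * i" by (simp add: e_def i_def)
  have "u t * (e' t + e t * (c t + t * e t)) = u t * e' t + e t * (u t * (c t + t * e t))"
    by (simp add: algebra_simps)
  then have "u t * (e' t + e t * (c t + t * e t)) = c'' t - 2 * c t * c' t"
    unfolding u_mult_e'[OF t] u_mult_c_plus_e[OF t] by simp
  then have e': "e' t + e t * (c t + t * e t) = (c'' t - 2 * c t * c' t) * i"
    using u_nonzero[OF t] by (simp add: i_def field_simps)
  obtain a b where coefficients: "c t = 2 * a" "c'' t = 3 * b"
    by (rule that[of "c t / 2" "c'' t / 3"]) simp_all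
  have cancel: "2 * a / 2 = a" "2 / 3 * (3 * b) = 2 * b" by simp_all
  have "hopf_curvature (gform (h z)) (\<Omega> z) (complex_line z)
      (c t) (c' t) (c t) (c' t) (c'' t) X Y Z \<bullet> U = squashed_curvature z X Y Z \<bullet> U" for U
    unfolding hopf_curvature_def two_form_curvature_def kulkarni_nomizu_def gform_linear_simps
    unfolding gform_h_\<Omega>[OF z] gform_h_complex_line[OF z]
    unfolding \<Omega>_complex_line[OF z] gform_h t_def[symmetric] quotient
    unfolding \<Omega>_def complex_line_def squashed_curvature_def Let_def t_def[symmetric] quotient e'
    unfolding e unfolding coefficients
    by (simp only: cancel inner_distribs inner_normalize[of X z Y Z U] t_def[symmetric]) algebra
  then show ?thesis unfolding t_def using vector_eq_rdot by blast
qed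

lemma curvature_h:
  assumes "z \<bullet> z \<in> {0..1}"
  shows "connection_curvature (\<Gamma> z) (\<Gamma>' z) X Y Z = hopf_curvature (gform (h z)) (\<Omega> z) (complex_line z)
      (c (z \<bullet> z)) (c' (z \<bullet> z)) (c (z \<bullet> z)) (c' (z \<bullet> z)) (c'' (z \<bullet> z)) X Y Z"
  using assms by (simp add: hopf_curvature_h connection_curvature_\<Gamma>)

definition root :: "real^'m \<Rightarrow> real^'m^'m" where
  "root z = (let v = sqrt (u (z \<bullet> z)) in squash (- c (z \<bullet> z) / (v * (v + 1))) (c (z \<bullet> z) / (v + 1)) z)"

definition root_inv :: "real^'m \<Rightarrow> real^'m^'m" where
  "root_inv z = (let v = sqrt (u (z \<bullet> z)) in squash (c (z \<bullet> z) / (v + 1)) (- c (z \<bullet> z) / (v * (v + 1))) z)"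

lemma root_coefficients:
  assumes z: "z \<bullet> z \<in> {0..1}"
  obtains p q where "root z = squash p q z" "root_inv z = squash q p z" "p + q + p * q * (z \<bullet> z) = 0"
    "2 * p + p\<^sup>2 * (z \<bullet> z) = - c (z \<bullet> z) / u (z \<bullet> z)" "2 * q + q\<^sup>2 * (z \<bullet> z) = c (z \<bullet> z)"
proof -
  define t v where "t = z \<bullet> z" and "v = sqrt (u t)"
  have u: "u t > 0" using u_pos[OF z] by (simp add: t_def)
  then have v: "v > 0" "v\<^sup>2 = u t" by (simp_all add: v_def)
  have c_mult_t: "c t * t = (v + 1) * (v - 1)" using v(2) by (simp add: u_def power2_eq_square algebra_simps)
  define p q where "p = - c t / (v * (v + 1))" and "q = c t / (v + 1)"
  have p_mult_v: "p * v = - q" and q_mult_v: "q * (v + 1) = c t" using v(1) by (simp_all add: p_def q_def)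
  have "q * t = c t * t / (v + 1)" by (simp add: q_def)
  also have "\<dots> = v - 1" unfolding c_mult_t using v(1) by simp
  finally have q_mult_t: "q * t = v - 1" .
  show ?thesis
  proof (rule that[of p q, folded t_def])
    show "root z = squash p q z" "root_inv z = squash q p z"
      by (simp_all add: root_def root_inv_def Let_def p_def q_def t_def v_def)
    show "p + q + p * q * t = 0" using p_mult_v q_mult_t by algebra
    have "2 * q + q\<^sup>2 * t = q * (2 + q * t)" by algebra
    then show "2 * q + q\<^sup>2 * t = c t" unfolding q_mult_t using q_mult_v by (simp add: algebra_simps)
    have "u t * (2 * p + p\<^sup>2 * t) = p * v * (2 * v + p * v * t)"
      unfolding v(2)[symmetric] by algebra
    also have "\<dots> = - q * (2 * v - q * t)" unfolding p_mult_v by simp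
    also have "\<dots> = - c t" unfolding q_mult_t using q_mult_v by (simp add: algebra_simps)
    finally have "u t * (2 * p + p\<^sup>2 * t) = - c t" .
    then show "2 * p + p\<^sup>2 * t = - c t / u t" using u by (simp add: field_simps)
  qed
qed

context
  fixes z :: "real^'m"
  assumes z: "z \<bullet> z \<in> {0..1}"
begin

lemma root_mult_root_inv: "root z ** root_inv z = mat 1" and root_inv_mult_root: "root_inv z ** root z = mat 1"
proof -
  obtain p q where "root z = squash p q z" "root_inv z = squash q p z" "p + q + p * q * (z \<bullet> z) = 0"
    using root_coefficients[OF z] by metis
  moreover from this(3) have "q + p + q * p * (z \<bullet> z) = 0" by (simp add: algebra_simps)
  ultimately show "root z ** root_inv z = mat 1" "root_inv z ** root z = mat 1"
    by (simp_all add: squash_mult_squash)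
qed

lemma root_root_inv [simp]: "root z *v (root_inv z *v X) = X" "root_inv z *v (root z *v X) = X"
  by (simp_all add: matrix_vector_mul_assoc root_mult_root_inv root_inv_mult_root)

lemma root_inner_root: "(root z *v X) \<bullet> (root z *v Y) = gform (h z) X Y"
proof -
  obtain p q where root: "root z = squash p q z" and "2 * p + p\<^sup>2 * (z \<bullet> z) = - c (z \<bullet> z) / u (z \<bullet> z)"
      "2 * q + q\<^sup>2 * (z \<bullet> z) = c (z \<bullet> z)"
    using root_coefficients[OF z] by metis
  then have "root z ** root z = h z"
    by (simp add: h_def squash_mult_squash power2_eq_square)
  then show ?thesis
    by (simp add: root inner_squash_left gform_def matrix_vector_mul_assoc)
qed

lemma root_complex_line: "root z *v complex_line z X = complex_line z (root z *v X)"
  by (simp add: root_def Let_def squash_complex_line)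

lemma root_symplectic: "(J *v (root z *v X)) \<bullet> (root z *v Y) = (J *v X) \<bullet> Y"
  using root_coefficients[OF z] squash_symplectic by metis

lemma root_\<Omega>: "root z *v \<Omega> z X = J *v (root z *v X)"
proof -
  have "(root z *v \<Omega> z X) \<bullet> (root z *v Y) = (J *v (root z *v X)) \<bullet> (root z *v Y)" for Y
    by (simp add: root_inner_root gform_h_\<Omega>[OF z] root_symplectic)
  then have "(root z *v \<Omega> z X) \<bullet> Y = (J *v (root z *v X)) \<bullet> Y" for Y
    using root_root_inv(1)[of Y] by metis
  then show ?thesis using vector_eq_rdot by blast
qed

lemma h_pos: "X \<noteq> 0 \<Longrightarrow> gform (h z) X X > 0"
  unfolding root_inner_root[symmetric] by (metis root_root_inv(2) inner_gt_zero_iff matrix_vector_mult_0_right)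

end

lemma gform_h_\<Gamma>:
  assumes z: "z \<bullet> z \<in> {0..1}"
  shows "gform (h z) (\<Gamma> z V X) Y = (let t = z \<bullet> z; w = J *v z in
     c t * ((w \<bullet> X) * ((J *v V) \<bullet> Y) + (w \<bullet> V) * ((J *v X) \<bullet> Y))
     - (c t / u t * (V \<bullet> X) + e t / u t * (z \<bullet> V) * (z \<bullet> X) + c' t * (w \<bullet> V) * (w \<bullet> X)) * (z \<bullet> Y)
     + c' t * ((z \<bullet> V) * (w \<bullet> X) + (w \<bullet> V) * (z \<bullet> X)) * (w \<bullet> Y))"
proof -
  define t where "t = z \<bullet> z"
  note t = z[folded t_def]
  have c': "c' t = u t * e t + (c t)\<^sup>2" using u_mult_e[OF t] by simp
  show ?thesis
    unfolding \<Gamma>_def Let_def gform_linear_simps gform_h_radial[OF z] gform_h_fibre[OF z]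
    unfolding gform_h_J[OF z] t_def[symmetric] c'
    using u_nonzero[OF t] by (simp add: field_simps power2_eq_square)
qed

lemma u_deriv: "(u has_real_derivative u' t) (at t)"
  unfolding u_def u'_def by (auto intro!: derivative_eq_intros c_deriv)

lemma c_div_u_deriv: "t \<in> {0..1} \<Longrightarrow> ((\<lambda>t. - c t / u t) has_real_derivative - e t / u t) (at t)"
  using u_nonzero
  by (auto intro!: derivative_eq_intros c_deriv u_deriv simp: e_def u'_def)
     (simp add: u_def field_simps power2_eq_square)

lemma e_deriv: "t \<in> {0..1} \<Longrightarrow> (e has_real_derivative e' t) (at t)"
  unfolding e_def using u_nonzero
  by (auto intro!: derivative_eq_intros c_deriv c'_deriv u_deriv
      simp: e'_def e_def field_simps power2_eq_square)

lemma levi_civita_h: "levi_civita (ball 0 1) h h' \<Gamma> \<Gamma>'"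
proof (rule levi_civita.intro)
  fix z :: "real^'m" assume "z \<in> ball 0 1"
  then have z: "z \<bullet> z \<in> {0..1}" by (rule inner_self_unit_interval)
  have J_deriv: "((\<lambda>z. J *v z) has_derivative (\<lambda>V. J *v V)) (at z)"
    by (rule bounded_linear_imp_has_derivative) simp
  note derivs = real_derivative_of_inner_self[OF c_deriv] real_derivative_of_inner_self[OF c'_deriv]
    real_derivative_of_inner_self[OF e_deriv[OF z]] real_derivative_of_inner_self[OF c_div_u_deriv[OF z]]
    real_derivative_of_inner_self[OF u_deriv]
  show "(h has_derivative h' z) (at z)"
    unfolding h_def squash_def
    by (rule derivative_eq_intros derivs bounded_bilinear.FDERIV[OF bounded_bilinear_outer] J_deriv refl)+
      (simp add: fun_eq_iff h'_def algebra_simps)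
  show sym: "transpose (h z) = h z" by (simp add: h_def transpose_squash)
  show "gform (h z) X X > 0" if "X \<noteq> 0" for X using h_pos[OF z that] .
  show "((\<lambda>z. \<Gamma> z X Y) has_derivative (\<lambda>V. \<Gamma>' z V X Y)) (at z)" for X Y
    unfolding \<Gamma>_def Let_def
    by (rule derivative_eq_intros derivs J_deriv refl)+
      (simp add: fun_eq_iff \<Gamma>'_def Let_def algebra_simps)
  show "linear (\<Gamma> z X)" for X
    by (rule linearI) (simp_all add: \<Gamma>_def Let_def inner_simps matrix_vector_right_distrib
        matrix_vector_mult_scaleR algebra_simps)
  show "\<Gamma> z X Y = \<Gamma> z Y X" for X Y
    by (simp add: \<Gamma>_def Let_def inner_commute algebra_simps)
  show "gform (h' z V) X Y = gform (h z) (\<Gamma> z V X) Y + gform (h z) X (\<Gamma> z V Y)" for V X Y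
    unfolding gform_commute[OF sym, of X] gform_h_\<Gamma>[OF z] h'_def gform_matrix_simps Let_def
      J_inner_commute[of Y X] inner_commute[of Y]
    by (simp add: algebra_simps)
qed simp

end

section \<open>Conformally compact metrics on the ball\<close>

locale squashed_ball = squashed_metric J c c' c''
  for J :: "real^'m^'m" and c c' c'' :: "real \<Rightarrow> real" +
  fixes \<kappa> :: real
  assumes \<kappa>_pos: "\<kappa> > 0"
begin

definition f :: "real \<Rightarrow> real" where "f t = 2 / (1 - t)"

definition g :: "'m mfield" where
  "g z = (\<kappa> * (f (z \<bullet> z))\<^sup>2) *\<^sub>R h z"

definition \<phi> :: "real^'m \<Rightarrow> real" where
  "\<phi> z = sqrt \<kappa> * f (z \<bullet> z)"

definition T :: "real^'m \<Rightarrow> real^'m" where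
  "T z = (f (z \<bullet> z) * u (z \<bullet> z)) *\<^sub>R z"

definition T' :: "real^'m \<Rightarrow> real^'m \<Rightarrow> real^'m" where
  "T' z V = (2 * (z \<bullet> V) * ((f (z \<bullet> z))\<^sup>2 / 2 * u (z \<bullet> z) + f (z \<bullet> z) * u' (z \<bullet> z))) *\<^sub>R z
     + (f (z \<bullet> z) * u (z \<bullet> z)) *\<^sub>R V"

lemma g_eq_conformal: "g = (\<lambda>z. (\<phi> z)\<^sup>2 *\<^sub>R h z)"
  using \<kappa>_pos by (simp add: fun_eq_iff g_def \<phi>_def power_mult_distrib)

context
  fixes z :: "real^'m"
  assumes z: "z \<in> ball 0 1"
begin

lemmas unit_interval = inner_self_unit_interval(1)[OF z]

lemma f_pos: "f (z \<bullet> z) > 0"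
  using inner_self_less_1[OF z] by (simp add: f_def)

lemma f_mult: "f (z \<bullet> z) * (z \<bullet> z) = f (z \<bullet> z) - 2"
  using inner_self_less_1[OF z] by (simp add: f_def field_simps)

lemma f_deriv: "(f has_real_derivative (f (z \<bullet> z))\<^sup>2 / 2) (at (z \<bullet> z))"
  unfolding f_def using inner_self_less_1[OF z]
  by (auto intro!: derivative_eq_intros simp: power2_eq_square)

lemma gform_h_T: "gform (h z) (T z) V = f (z \<bullet> z) * (z \<bullet> V)"
  using u_nonzero[OF unit_interval] by (simp add: T_def gform_linear_simps gform_h_radial[OF unit_interval])

lemma hessian_T:
  "T' z V + \<Gamma> z V (T z) = ((f (z \<bullet> z))\<^sup>2 * u (z \<bullet> z) * (z \<bullet> V)) *\<^sub>R z
     + (f (z \<bullet> z) * u (z \<bullet> z)) *\<^sub>R V + (f (z \<bullet> z) * u' (z \<bullet> z)) *\<^sub>R complex_line z V"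
proof -
  define t where "t = z \<bullet> z"
  have "\<Gamma> z V (T z) = (f t * (u t * (c t + t * e t))) *\<^sub>R (((J *v z) \<bullet> V) *\<^sub>R (J *v z) - (z \<bullet> V) *\<^sub>R z)"
    by (simp add: \<Gamma>_def T_def Let_def t_def inner_simps matrix_vector_mult_scaleR inner_commute algebra_simps)
  also have "u t * (c t + t * e t) = u' t"
    unfolding t_def by (rule u_mult_c_plus_e[OF unit_interval])
  finally show ?thesis
    by (simp add: vec_eq_iff T'_def complex_line_def t_def algebra_simps)
qed

end

sublocale conformal_change "ball 0 1" h h' \<Gamma> \<Gamma>' \<phi> T T'
proof (rule conformal_change.intro[OF levi_civita_h], rule conformal_change_axioms.intro)
  fix z :: "real^'m" assume z: "z \<in> ball 0 1"
  note f = real_derivative_of_inner_self[OF f_deriv[OF z]]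
    and u = real_derivative_of_inner_self[OF u_deriv]
  show "\<phi> z \<noteq> 0" using f_pos[OF z] \<kappa>_pos by (simp add: \<phi>_def)
  show "(\<phi> has_derivative (\<lambda>V. \<phi> z * gform (h z) (T z) V)) (at z)"
    unfolding \<phi>_def gform_h_T[OF z]
    by (rule derivative_eq_intros f refl)+ (simp add: fun_eq_iff power2_eq_square)
  show "(T has_derivative T' z) (at z)"
    unfolding T_def by (rule derivative_eq_intros f u refl)+ (simp add: fun_eq_iff T'_def algebra_simps)
  show "gform (h z) (T' z V + \<Gamma> z V (T z)) W = gform (h z) (T' z W + \<Gamma> z W (T z)) V" for V W
    unfolding hessian_T[OF z] gform_linear_simps gform_h_radial[OF unit_interval[OF z]]
      gform_h_complex_line[OF unit_interval[OF z]]
    by (simp add: gform_h inner_commute[of W V] algebra_simps)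
qed

lemma schouten_change_eq:
  assumes "z \<in> ball 0 1"
  shows "schouten_change z V
    = ((f (z \<bullet> z))\<^sup>2 * u (z \<bullet> z) / 2) *\<^sub>R V + (f (z \<bullet> z) * u' (z \<bullet> z)) *\<^sub>R complex_line z V"
proof -
  have "gform (h z) (T z) (T z) = f (z \<bullet> z) * u (z \<bullet> z) * (f (z \<bullet> z) * (z \<bullet> z))"
    by (simp add: gform_h_T[OF assms]) (simp add: T_def)
  then have norm_T: "gform (h z) (T z) (T z) / 2 = (f (z \<bullet> z))\<^sup>2 * u (z \<bullet> z) / 2 - f (z \<bullet> z) * u (z \<bullet> z)"
    unfolding f_mult[OF assms] by (simp add: power2_eq_square field_simps)
  show ?thesis
    unfolding schouten_change_def norm_T unfolding hessian_T[OF assms] gform_h_T[OF assms]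
    by (simp add: T_def scaleR_diff_left power2_eq_square mult_ac)
qed

lemma riem_vec_g:
  assumes z: "z \<in> ball 0 1"
  shows "riem_vec g z X Y Z = hopf_curvature (gform (h z)) (\<Omega> z) (complex_line z)
      (c (z \<bullet> z) + (f (z \<bullet> z))\<^sup>2 * u (z \<bullet> z)) (c' (z \<bullet> z) + f (z \<bullet> z) * u' (z \<bullet> z))
      (c (z \<bullet> z)) (c' (z \<bullet> z)) (c'' (z \<bullet> z)) X Y Z"
proof -
  have kulkarni_nomizu_add: "kulkarni_nomizu (gform A) (\<lambda>V. P V + Q V) X Y Z
      = kulkarni_nomizu (gform A) P X Y Z + kulkarni_nomizu (gform A) Q X Y Z" for A P Q
    by (simp add: kulkarni_nomizu_def gform_linear_simps algebra_simps)
  have "riem_vec g z X Y Z = connection_curvature (conformal_\<Gamma> z) (conformal_\<Gamma>' z) X Y Z"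
    unfolding g_eq_conformal using levi_civita.riem_vec_eq[OF levi_civita_conformal z] .
  also have "\<dots> = hopf_curvature (gform (h z)) (\<Omega> z) (complex_line z) (c (z \<bullet> z)) (c' (z \<bullet> z))
        (c (z \<bullet> z)) (c' (z \<bullet> z)) (c'' (z \<bullet> z)) X Y Z
      - kulkarni_nomizu (gform (h z)) (schouten_change z) X Y Z"
    unfolding curvature_conformal[OF z] curvature_h[OF unit_interval[OF z]] ..
  also have "\<dots> = hopf_curvature (gform (h z)) (\<Omega> z) (complex_line z)
      (c (z \<bullet> z) + (f (z \<bullet> z))\<^sup>2 * u (z \<bullet> z)) (c' (z \<bullet> z) + f (z \<bullet> z) * u' (z \<bullet> z))
      (c (z \<bullet> z)) (c' (z \<bullet> z)) (c'' (z \<bullet> z)) X Y Z"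
  proof -
    have "(\<lambda>V. ((c (z \<bullet> z) + (f (z \<bullet> z))\<^sup>2 * u (z \<bullet> z)) / 2) *\<^sub>R V
          + (c' (z \<bullet> z) + f (z \<bullet> z) * u' (z \<bullet> z)) *\<^sub>R complex_line z V)
        = (\<lambda>V. ((c (z \<bullet> z) / 2) *\<^sub>R V + c' (z \<bullet> z) *\<^sub>R complex_line z V) + schouten_change z V)"
      by (simp add: fun_eq_iff schouten_change_eq[OF z] add_divide_distrib algebra_simps)
    then show ?thesis by (simp add: hopf_curvature_def kulkarni_nomizu_add)
  qed
  finally show ?thesis .
qed

abbreviation model_curvature :: "real^'m \<Rightarrow> real^'m \<Rightarrow> real^'m \<Rightarrow> real^'m \<Rightarrow> real^'m" where
  "model_curvature z \<equiv> hopf_curvature (\<bullet>) ((*v) J) (complex_line z)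
      (c (z \<bullet> z) + (f (z \<bullet> z))\<^sup>2 * u (z \<bullet> z)) (c' (z \<bullet> z) + f (z \<bullet> z) * u' (z \<bullet> z))
      (c (z \<bullet> z)) (c' (z \<bullet> z)) (c'' (z \<bullet> z))"

lemma root_riem_vec_g:
  assumes z: "z \<in> ball 0 1"
  shows "root z *v riem_vec g z X Y Z = model_curvature z (root z *v X) (root z *v Y) (root z *v Z)"
proof -
  note t = unit_interval[OF z]
  show ?thesis
    unfolding riem_vec_g[OF z]
    by (intro hopf_curvature_transfer matrix_vector_mul_linear)
      (simp_all add: root_inner_root[OF t] root_\<Omega>[OF t] root_complex_line[OF t])
qed

lemma ricci_g:
  assumes z: "z \<in> ball 0 1"
  shows "ricci g i j z =
    - ((real CARD('m) - 1) * (c (z \<bullet> z) + (f (z \<bullet> z))\<^sup>2 * u (z \<bullet> z))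
         + 2 * (z \<bullet> z) * (c' (z \<bullet> z) + f (z \<bullet> z) * u' (z \<bullet> z)) + 3 * c (z \<bullet> z)) * h z $ i $ j
    - ((real CARD('m) - 2) * (c' (z \<bullet> z) + f (z \<bullet> z) * u' (z \<bullet> z)) + 6 * c' (z \<bullet> z)
         + 2 * (z \<bullet> z) * c'' (z \<bullet> z)) * gform (h z) (complex_line z (axis i 1)) (axis j 1)"
proof -
  note t = unit_interval[OF z]
  let ?L = "\<lambda>X. riem_vec g z X (axis i 1) (axis j 1)"
  let ?M = "\<lambda>X. model_curvature z X (root z *v axis i 1) (root z *v axis j 1)"
  have linear: "linear ?L"
    unfolding g_eq_conformal using levi_civita.riem_vec_linear[OF levi_civita_conformal z] .
  have "ricci g i j z = trace (matrix ?L)"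
    unfolding g_eq_conformal using levi_civita.ricci_eq[OF levi_civita_conformal z] .
  also have "\<dots> = trace (matrix (\<lambda>X. root z *v ?L (root_inv z *v X)))"
    using trace_matrix_conjugate[OF linear root_inv_mult_root[OF t]] by simp
  also have "(\<lambda>X. root z *v ?L (root_inv z *v X)) = ?M"
    by (simp add: root_riem_vec_g[OF z] root_root_inv[OF t])
  finally show ?thesis
    by (simp add: trace_hopf_curvature root_inner_root[OF t] root_complex_line[OF t, symmetric] gform_axis)
qed

lemma sec_curv_g:
  assumes z: "z \<in> ball 0 1"
  shows "sec_curv g z X Y = (model_curvature z (root z *v X) (root z *v Y) (root z *v Y) \<bullet> (root z *v X))
     / (\<kappa> * (f (z \<bullet> z))\<^sup>2 * gram (root z *v X) (root z *v Y))"
proof -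
  have gform_g: "gform (g z) X Y = \<kappa> * (f (z \<bullet> z))\<^sup>2 * ((root z *v X) \<bullet> (root z *v Y))" for X Y
    by (simp add: g_def gform_matrix_simps root_inner_root[OF unit_interval[OF z]])
  have "gform (g z) X X * gform (g z) Y Y - (gform (g z) X Y)\<^sup>2
      = (\<kappa> * (f (z \<bullet> z))\<^sup>2)\<^sup>2 * gram (root z *v X) (root z *v Y)"
    unfolding gform_g gram_def by algebra
  moreover have "\<kappa> * (f (z \<bullet> z))\<^sup>2 \<noteq> 0" using \<kappa>_pos f_pos[OF z] by simp
  ultimately show ?thesis
    unfolding sec_curv_def by (simp add: gform_g root_riem_vec_g[OF z] power2_eq_square[of "_ * _"])
qed

lemma smooth_g:
  assumes c_smooth: "\<And>n. Ck_on n (\<lambda>z. c (z \<bullet> z)) (ball 0 1 :: (real^'m) set)"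
  shows "smooth_on_set g (ball 0 1)"
  unfolding smooth_on_set_def
proof
  fix n
  let ?B = "ball 0 1 :: (real^'m) set"
  have B: "open ?B" by simp
  have id: "Ck_on n (\<lambda>z. z) ?B" and J: "Ck_on n (\<lambda>z. J *v z) ?B"
    by (intro Ck_on_linear[OF B] matrix_vector_mul_bounded_linear bounded_linear_ident)+
  have t: "Ck_on n (\<lambda>z. z \<bullet> z) ?B" by (rule Ck_on_inner[OF B id id])
  note rules = Ck_on_add Ck_on_mult Ck_on_scaleR Ck_on_outer Ck_on_const B c_smooth t id J
  have u: "Ck_on n (\<lambda>z. inverse (u (z \<bullet> z))) ?B"
  proof (rule Ck_on_inverse[OF B u_nonzero[OF unit_interval]])
    show "Ck_on n (\<lambda>z. u (z \<bullet> z)) ?B" unfolding u_def by (intro rules)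
  qed
  have f: "Ck_on n (\<lambda>z. 2 * inverse (1 + (-1) * (z \<bullet> z))) ?B"
    using inner_self_less_1 by (intro Ck_on_inverse rules) force
  have "Ck_on n (\<lambda>z. (\<kappa> * ((2 * inverse (1 + (-1) * (z \<bullet> z))) * (2 * inverse (1 + (-1) * (z \<bullet> z)))))
      *\<^sub>R (mat 1 + (((-1) * c (z \<bullet> z)) * inverse (u (z \<bullet> z))) *\<^sub>R outer z z
          + c (z \<bullet> z) *\<^sub>R outer (J *v z) (J *v z))) ?B" (is "Ck_on n ?g ?B")
    by (intro rules f u)
  also have "?g = g"
    by (simp add: fun_eq_iff g_def h_def squash_def f_def divide_inverse power2_eq_square)
  finally show "Ck_on n g ?B" .
qed

lemma riem_metric_g:
  assumes "smooth_on_set g (ball 0 1)"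
  shows "riem_metric g"
  unfolding riem_metric_def
proof (intro conjI ballI allI impI assms)
  fix z v :: "real^'m" assume z: "z \<in> ball 0 1"
  show "transpose (g z) = g z" "v \<noteq> 0 \<Longrightarrow> gform (g z) v v > 0"
    unfolding g_eq_conformal using levi_civita.g_sym levi_civita.g_pos levi_civita_conformal z by blast+
qed

lemma continuous_on_c: "continuous_on S c" and continuous_on_u: "continuous_on S u"
proof -
  show c: "continuous_on S c"
    using c_deriv DERIV_isCont continuous_at_imp_continuous_on by blast
  show "continuous_on S u" unfolding u_def by (intro continuous_intros c)
qed

lemma continuous_on_squash:
  assumes "continuous_on S p" "continuous_on S q"
  shows "continuous_on S (\<lambda>z. squash (p z) (q z) z)"
  unfolding squash_def
  by (intro continuous_intros assms bounded_bilinear.continuous_on[OF bounded_bilinear_outer]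
      bounded_linear.continuous_on[OF matrix_vector_mul_bounded_linear])

lemma continuous_on_h: "continuous_on (cball 0 1) h"
  unfolding h_def
proof (rule continuous_on_squash)
  have "u t \<noteq> 0" if "t \<in> {0..1}" for t using u_pos[OF that] by simp
  then show "continuous_on (cball 0 1) (\<lambda>z::real^'m. - c (z \<bullet> z) / u (z \<bullet> z))"
    using continuous_on_radial[of "\<lambda>t. - c t / u t"]
    by (simp add: continuous_on_divide continuous_on_minus continuous_on_c continuous_on_u)
qed (rule continuous_on_radial[OF continuous_on_c])

lemma continuous_on_root_inv: "continuous_on (cball 0 1) root_inv"
proof -
  let ?v = "\<lambda>t. sqrt (u t)"
  have v: "continuous_on {0..1} ?v" by (intro continuous_intros continuous_on_u)
  have "?v t > 0" if "t \<in> {0..1}" for t using u_pos[OF that] by simp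
  then have "?v t + 1 \<noteq> 0" "?v t * (?v t + 1) \<noteq> 0" if "t \<in> {0..1}" for t
    using that by (smt (verit) mult_pos_pos)+
  then have "continuous_on {0..1} (\<lambda>t. c t / (?v t + 1))"
      "continuous_on {0..1} (\<lambda>t. - c t / (?v t * (?v t + 1)))"
    by (intro continuous_on_divide continuous_on_minus continuous_on_mult continuous_on_add continuous_on_const
        continuous_on_c v; blast)+
  then show ?thesis
    unfolding root_inv_def Let_def by (intro continuous_on_squash continuous_on_radial)
qed

lemma h_lower_bound:
  obtains d where "d > 0" "\<And>z v. z \<in> cball 0 1 \<Longrightarrow> d * (norm v)\<^sup>2 \<le> gform (h z) v v"
proof -
  have "bounded (root_inv ` cball 0 1)"
    by (intro compact_imp_bounded compact_continuous_image continuous_on_root_inv compact_cball)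
  then obtain B where B: "B > 0" "\<And>z. z \<in> cball 0 1 \<Longrightarrow> norm (root_inv z) \<le> B"
    unfolding bounded_pos by auto
  show ?thesis
  proof (rule that[of "1 / B\<^sup>2"])
    show "1 / B\<^sup>2 > 0" using B(1) by simp
    fix z v :: "real^'m" assume z: "z \<in> cball 0 1"
    note t = inner_self_unit_interval(2)[OF z]
    have "norm v = norm (root_inv z *v (root z *v v))" by (simp add: root_root_inv[OF t])
    also have "\<dots> \<le> B * norm (root z *v v)"
      using norm_matrix_vector_mult_le B(2)[OF z] by (meson mult_right_mono norm_ge_zero order_trans)
    finally have "(norm v)\<^sup>2 \<le> B\<^sup>2 * (norm (root z *v v))\<^sup>2"
      by (metis power_mono norm_ge_zero power_mult_distrib)
    then show "1 / B\<^sup>2 * (norm v)\<^sup>2 \<le> gform (h z) v v"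
      using B(1) by (simp add: root_inner_root[OF t, symmetric] power2_norm_eq_inner field_simps)
  qed
qed

lemma complete_g:
  assumes "smooth_on_set g (ball 0 1)"
  shows "complete_metric g"
proof -
  obtain d where d: "d > 0" "\<And>z v. z \<in> cball 0 1 \<Longrightarrow> d * (norm v)\<^sup>2 \<le> gform (h z) v v"
    using h_lower_bound by blast
  have "hyperbolic_lower_bound g (sqrt (4 * \<kappa> * d))"
  proof
    show "continuous_on (ball 0 1) g" using assms by (metis Ck_on.simps(1) smooth_on_set_def)
    show "sqrt (4 * \<kappa> * d) > 0" using d(1) \<kappa>_pos by simp
    fix z v :: "real^'m" assume z: "z \<in> ball 0 1"
    have "(sqrt (4 * \<kappa> * d) * norm v / (1 - z \<bullet> z))\<^sup>2 = \<kappa> * (f (z \<bullet> z))\<^sup>2 * (d * (norm v)\<^sup>2)"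
      using d(1) \<kappa>_pos by (simp add: f_def power_divide power_mult_distrib)
    also have "\<dots> \<le> gform (g z) v v"
      unfolding g_def gform_matrix_simps using d(2)[of z v] z \<kappa>_pos by (intro mult_left_mono) auto
    finally show "(sqrt (4 * \<kappa> * d) * norm v / (1 - z \<bullet> z))\<^sup>2 \<le> gform (g z) v v" .
  qed
  then show ?thesis by (rule hyperbolic_lower_bound.complete)
qed

theorem CCE_g:
  assumes smooth: "smooth_on_set g (ball 0 1)" and "einstein_neg g"
  shows "CCE_with_infinity J (1 / u 1) g"
proof -
  have extension: "(4 * \<kappa>) *\<^sub>R h p = (1 - p \<bullet> p)\<^sup>2 *\<^sub>R g p" if "p \<in> ball 0 1" for p
    using inner_self_less_1[OF that] by (simp add: g_def f_def power_divide)
  have infinity: "gform ((4 * \<kappa>) *\<^sub>R h p) v w = 4 * \<kappa> * u 1 * ghat J (1 / u 1) p v w"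
    if "p \<in> sphere 0 1" "v \<bullet> p = 0" "w \<bullet> p = 0" for p v w
  proof -
    have p: "p \<bullet> p = 1" using that(1) by (simp add: norm_eq_1)
    have "u 1 \<noteq> 0" using u_pos[of 1] by simp
    then have "u 1 * ghat J (1 / u 1) p v w = v \<bullet> w + (u 1 - 1) * ((J *v p) \<bullet> v) * ((J *v p) \<bullet> w)"
      by (simp add: ghat_def algebra_simps)
    also have "\<dots> = gform (h p) v w"
      using that(2,3) unfolding gform_h p u_def by (simp add: inner_commute[of p v] inner_commute[of p w])
    finally show ?thesis by (simp add: gform_matrix_simps mult.assoc)
  qed
  have continuous: "continuous_on (cball 0 1) (\<lambda>p. (4 * \<kappa>) *\<^sub>R h p)"
    by (intro continuous_intros continuous_on_h)
  have "4 * \<kappa> * u 1 > 0" using \<kappa>_pos u_pos[of 1] by simp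
  then have "\<exists>gbar k. continuous_on (cball 0 1) gbar \<and> (\<forall>p\<in>ball 0 1. gbar p = (1 - p \<bullet> p)\<^sup>2 *\<^sub>R g p) \<and>
      (\<forall>p\<in>sphere 0 1. k p > 0 \<and> (\<forall>v w. v \<bullet> p = 0 \<longrightarrow> w \<bullet> p = 0 \<longrightarrow>
          gform (gbar p) v w = k p * ghat J (1 / u 1) p v w))"
    by (intro exI[of _ "\<lambda>p. (4 * \<kappa>) *\<^sub>R h p"] exI[of _ "\<lambda>_. 4 * \<kappa> * u 1"] conjI ballI allI impI)
      (assumption | rule continuous extension infinity)+
  then show ?thesis
    unfolding CCE_with_infinity_def
    using riem_metric_g[OF smooth] complete_g[OF smooth] assms(2) defining_fun_1_minus_inner_self by blast
qed

end

section \<open>The Taub-NUT family\<close>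

definition frames :: "((real^'m) \<times> (real^'m) \<times> (real^'m)) set" where
  "frames = {(z, X, Y). norm z \<le> 1 \<and> norm X = 1 \<and> norm Y = 1 \<and> X \<bullet> Y = 0}"

lemma compact_frames: "compact (frames :: ((real^'m) \<times> (real^'m) \<times> (real^'m)) set)"
proof -
  have eq: "frames = (cball 0 1 \<times> sphere 0 1 \<times> sphere 0 1) \<inter>
      {q :: (real^'m) \<times> (real^'m) \<times> (real^'m). fst (snd q) \<bullet> snd (snd q) = 0}"
    by (auto simp: frames_def)
  show ?thesis
    unfolding eq
    by (intro compact_Int_closed compact_Times compact_cball compact_sphere closed_Collect_eq continuous_intros)
qed

lemma frames_gram: "(z, X, Y) \<in> frames \<Longrightarrow> gram X Y = 1"
  by (auto simp: frames_def gram_def norm_eq_1)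

lemma frames_lin_indep2: "(z, X, Y) \<in> frames \<Longrightarrow> lin_indep2 X Y"
  by (auto simp: frames_def intro: orthonormal_lin_indep2)

context complex_structure
begin

lemma sectional_hopf_curvature:
  "hopf_curvature (\<bullet>) ((*v) J) (complex_line z) r s c c' c'' X Y Y \<bullet> X =
    - r * gram X Y
    - s * ((complex_line z X \<bullet> X) * (Y \<bullet> Y) + (complex_line z Y \<bullet> Y) * (X \<bullet> X)
        - 2 * (complex_line z X \<bullet> Y) * (X \<bullet> Y))
    - 3 * c * ((J *v X) \<bullet> Y)\<^sup>2 - 6 * c' * ((J *v X) \<bullet> Y) * ((J *v complex_line z X) \<bullet> Y)
    - 2 * c'' * ((J *v complex_line z X) \<bullet> Y)\<^sup>2"
proof -
  have skew: "(J *v complex_line z Y) \<bullet> X = - ((J *v complex_line z X) \<bullet> Y)" for X Y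
    unfolding J_inner_commute[of "complex_line z Y" X] J_complex_line[of z X] complex_line_inner[of z _ Y] ..
  have skew_self: "(J *v complex_line z Y) \<bullet> Y = 0" using skew[of Y Y] by simp
  have sym: "complex_line z Y \<bullet> X = complex_line z X \<bullet> Y" "Y \<bullet> X = X \<bullet> Y"
    using complex_line_inner[of z Y X] by (simp_all add: inner_commute)
  show ?thesis
    unfolding hopf_curvature_def two_form_curvature_def kulkarni_nomizu_def inner_simps
      skew_self skew[of Y X] J_inner_commute[of Y X] sym J_inner_self gram_def
    by (simp add: field_simps power2_eq_square)
qed

text \<open>The sectional Weyl curvature of the Taub-NUT metrics, divided by \<open>\<lambda> - 1\<close> and read in the Euclidean
  model.\<close>
definition weyl :: "nat \<Rightarrow> real^'m \<Rightarrow> real^'m \<Rightarrow> real^'m \<Rightarrow> real" where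
  "weyl k z X Y = (let t = z \<bullet> z; \<rho> = (1 - t) / 2; p = poly (profile k) t; p' = poly (pderiv (profile k)) t;
       p'' = poly (pderiv (pderiv (profile k))) t in
     - (hopf_curvature (\<bullet>) ((*v) J) (complex_line z) (p * (\<rho>\<^sup>2 + t) - 1) (\<rho>\<^sup>2 * p' + \<rho> * (p + t * p'))
          (\<rho>\<^sup>2 * p) (\<rho>\<^sup>2 * p') (\<rho>\<^sup>2 * p'') X Y Y \<bullet> X))"

lemma weyl_sphere:
  assumes "norm z = 1"
  shows "weyl k z X Y = 0"
proof -
  have "z \<bullet> z = 1" using assms by (simp add: norm_eq_1)
  then show ?thesis by (simp add: weyl_def sectional_hopf_curvature profile_at_1)
qed

lemma weyl_change_of_basis: "weyl k z (a *\<^sub>R X) (b *\<^sub>R Y + d *\<^sub>R X) = (a * b)\<^sup>2 * weyl k z X Y"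
  unfolding weyl_def Let_def sectional_hopf_curvature gram_def complex_line_def
  by (simp only: inner_distribs inner_commute[of Y X] inner_commute[of X z] inner_commute[of Y z] scaleR_scaleR
      J_inner_commute[of Y X] J_inner_commute[of X z] J_inner_commute[of Y z]) algebra

lemma continuous_on_weyl: "continuous_on S (\<lambda>(z, X, Y). weyl k z X Y)"
proof -
  have poly: "continuous_on S (\<lambda>q. poly P (fst q \<bullet> fst q))" for P :: "real poly"
    by (induction P) (auto intro!: continuous_intros)
  show ?thesis
    unfolding weyl_def Let_def sectional_hopf_curvature gram_def complex_line_def case_prod_unfold
    by (intro continuous_intros poly bounded_linear.continuous_on[OF matrix_vector_mul_bounded_linear[of J]])
      simp_all
qed

lemma frames_nonempty: "frames \<noteq> ({} :: ((real^'m) \<times> (real^'m) \<times> (real^'m)) set)"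
proof -
  have "norm (J *v axis i 1) = 1" for i by (simp add: norm_eq_1)
  then have "(0, axis undefined 1, J *v axis undefined 1) \<in> frames" by (simp add: frames_def)
  then show ?thesis by blast
qed

lemma weyl_attains_max:
  fixes s :: real
  obtains z0 X0 Y0 where "(z0, X0, Y0) \<in> frames"
    "\<And>z X Y. (z, X, Y) \<in> frames \<Longrightarrow> s * weyl k z X Y \<le> s * weyl k z0 X0 Y0"
proof -
  have "continuous_on frames (\<lambda>q. s * (case q of (z, X, Y) \<Rightarrow> weyl k z X Y))"
    by (intro continuous_intros continuous_on_weyl)
  then obtain q where "q \<in> frames" "\<And>q'. q' \<in> frames \<Longrightarrow>
      s * (case q' of (z, X, Y) \<Rightarrow> weyl k z X Y) \<le> s * (case q of (z, X, Y) \<Rightarrow> weyl k z X Y)"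
    using continuous_attains_sup[OF compact_frames frames_nonempty] by blast
  then show ?thesis using that by (cases q) fastforce
qed

end

text \<open>The Einstein equation for \<open>c = d P\<close> with \<open>P\<close> the profile, split into the coefficients of \<open>h\<close> and of the
  complex line in \<open>ricci_g\<close>.\<close>
lemma profile_einstein:
  fixes k :: nat and t F d :: real
  defines "p \<equiv> poly (profile k) t" and "p' \<equiv> poly (pderiv (profile k)) t"
    and "p'' \<equiv> poly (pderiv (pderiv (profile k))) t"
  assumes F: "F * (1 - t) = 2"
  shows "(2 * real k + 1) * (d * p + F\<^sup>2 * (1 + t * (d * p)))
      + 2 * t * (d * p' + F * (d * p + t * (d * p'))) + 3 * (d * p) = (2 * real k + 1) * (1 + d) * F\<^sup>2"
      (is "?h = ?r")
    and "2 * real k * (d * p' + F * (d * p + t * (d * p'))) + 6 * (d * p') + 2 * t * (d * p'') = 0"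
      (is "?line = 0")
proof -
  have t: "1 - t \<noteq> 0" using F by auto
  have "(1 - t)\<^sup>2 * (?h - ?r)
      = (2 * real k + 1) * ((1 - t)\<^sup>2 * (d * p) + (F * (1 - t))\<^sup>2 * (t * (d * p) - d))
        + 2 * t * (1 - t) * ((1 - t) * (d * p') + F * (1 - t) * (d * p + t * (d * p')))
        + 3 * (1 - t)\<^sup>2 * (d * p)"
    by algebra
  also have "\<dots> = 2 * d * (t * (1 - t\<^sup>2) * p' + (real k + 2 + 2 * real k * t + real k * t\<^sup>2) * p
      - (4 * real k + 2))"
    unfolding F by algebra
  finally have "(1 - t)\<^sup>2 * (?h - ?r) = 0"
    unfolding p_def p'_def profile_first_integral by simp
  then show "?h = ?r" using t by simp
  have "(1 - t) * ?line = 2 * real k * ((1 - t) * (d * p') + F * (1 - t) * (d * p + t * (d * p')))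
      + (1 - t) * (6 * (d * p') + 2 * t * (d * p''))"
    by algebra
  also have "\<dots> = 2 * d * (t * (1 - t) * p'' + (real k + 3 + (real k - 3) * t) * p' + 2 * real k * p)"
    unfolding F by algebra
  finally have "(1 - t) * ?line = 0"
    unfolding p_def p'_def p''_def profile_hypergeometric by simp
  then show "?line = 0" using t by simp
qed

locale taub_nut = complex_structure J for J :: "real^'m^'m" +
  fixes k :: nat and lam :: real
  assumes card: "CARD('m) = 2 * k + 2" and lam_pos: "lam > 0"
begin

sublocale squashed_ball J "\<lambda>t. (1 / lam - 1) * poly (profile k) t"
  "\<lambda>t. (1 / lam - 1) * poly (pderiv (profile k)) t"
  "\<lambda>t. (1 / lam - 1) * poly (pderiv (pderiv (profile k))) t" "1 / lam"
proof
  show "0 < 1 + t * ((1 / lam - 1) * poly (profile k) t)" if "t \<in> {0..1}" for t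
    using profile_factor_pos[OF _ that] lam_pos by simp
qed (use lam_pos in \<open>auto intro!: derivative_eq_intros poly_DERIV\<close>)

definition metric :: "'m mfield" where "metric = g"

lemma model_curvature_weyl:
  assumes "z \<in> ball 0 1"
  shows "model_curvature z X Y Y \<bullet> X
    = (f (z \<bullet> z))\<^sup>2 * ((1 - 1 / lam) * weyl k z X Y - 1 / lam * gram X Y)"
proof -
  define t F where "t = z \<bullet> z" and "F = f t"
  define \<rho> where "\<rho> = (1 - t) / 2"
  define p p' p'' where "p = poly (profile k) t" and "p' = poly (pderiv (profile k)) t"
    and "p'' = poly (pderiv (pderiv (profile k))) t"
  define d where "d = 1 / lam - 1"
  have F: "F * \<rho> = 1" using inner_self_less_1[OF assms] by (simp add: F_def \<rho>_def f_def t_def)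
  have coefficients: "d * p + F\<^sup>2 * (1 + t * (d * p)) = F\<^sup>2 * (d * (p * (\<rho>\<^sup>2 + t)) + 1)"
    "d * p' + F * (d * p + t * (d * p')) = F\<^sup>2 * (d * (\<rho>\<^sup>2 * p' + \<rho> * (p + t * p')))"
    "d * p = F\<^sup>2 * (d * (\<rho>\<^sup>2 * p))" "d * p' = F\<^sup>2 * (d * (\<rho>\<^sup>2 * p'))" "d * p'' = F\<^sup>2 * (d * (\<rho>\<^sup>2 * p''))"
    using F by algebra+
  have lam: "1 - 1 / lam = - d" "1 / lam * gram X Y = (d + 1) * gram X Y" by (simp_all add: d_def)
  show ?thesis
    unfolding sectional_hopf_curvature weyl_def Let_def u_def u'_def t_def[symmetric] F_def[symmetric]
      \<rho>_def[symmetric] p_def[symmetric] p'_def[symmetric] p''_def[symmetric] lam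
    unfolding d_def[symmetric] unfolding coefficients(1,2) unfolding coefficients(3-5)
    by algebra
qed

lemma sec_curv_metric:
  assumes z: "z \<in> ball 0 1" and XY: "lin_indep2 X Y"
  shows "sec_curv metric z X Y
    = - 1 + (lam - 1) * (weyl k z (root z *v X) (root z *v Y) / gram (root z *v X) (root z *v Y))"
proof -
  define W G where "W = weyl k z (root z *v X) (root z *v Y)" and "G = gram (root z *v X) (root z *v Y)"
  have "G > 0"
    using gram_pos lin_indep2_image[OF root_inv_mult_root[OF unit_interval[OF z]] XY]
    by (simp add: G_def)
  then show ?thesis
    unfolding metric_def sec_curv_g[OF z] model_curvature_weyl[OF z] W_def[symmetric] G_def[symmetric]
    using lam_pos f_pos[OF z] by (simp add: field_simps)
qed

lemma einstein_metric: "einstein_neg metric"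
  unfolding einstein_neg_def metric_def
proof (intro ballI allI)
  fix z :: "real^'m" and i j assume z: "z \<in> ball 0 1"
  have f_mult: "f (z \<bullet> z) * (1 - z \<bullet> z) = 2"
    using inner_self_less_1[OF z] by (simp add: f_def field_simps)
  have dim: "real CARD('m) - 1 = 2 * real k + 1" "real CARD('m) - 2 = 2 * real k" by (simp_all add: card)
  have "ricci g i j z = - ((2 * real k + 1) * (1 / lam) * (f (z \<bullet> z))\<^sup>2) * h z $ i $ j"
    unfolding ricci_g[OF z] u_def u'_def dim profile_einstein[OF f_mult] by simp
  also have "\<dots> = - (real CARD('m) - 1) * g z $ i $ j"
  proof -
    have "g z $ i $ j = 1 / lam * (f (z \<bullet> z))\<^sup>2 * h z $ i $ j" by (simp add: g_def)
    then show ?thesis unfolding dim by (simp only: mult_minus_left mult.assoc)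
  qed
  finally show "ricci g i j z = - (real CARD('m) - 1) * g z $ i $ j" .
qed

lemma CCE_metric: "CCE_with_infinity J lam metric"
proof -
  have "Ck_on n (\<lambda>z::real^'m. (1 / lam - 1) * poly (profile k) (z \<bullet> z)) (ball 0 1)" for n
    by (intro Ck_on_mult Ck_on_const Ck_on_poly Ck_on_inner Ck_on_linear[OF _ bounded_linear_ident] open_ball)
  then have "CCE_with_infinity J (1 / u 1) g"
    using einstein_metric by (intro CCE_g smooth_g) (simp_all add: metric_def)
  moreover have "1 / u 1 = lam" using lam_pos by (simp add: u_def profile_at_1)
  ultimately show ?thesis by (simp add: metric_def)
qed

lemma nonpos_curved_metric:
  assumes "\<And>z X Y. (z, X, Y) \<in> frames \<Longrightarrow> (lam - 1) * weyl k z X Y \<le> 1"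
  shows "nonpos_curved metric"
  unfolding nonpos_curved_def
proof (intro ballI allI impI)
  fix z X Y :: "real^'m" assume z: "z \<in> ball 0 1" and XY: "lin_indep2 X Y"
  define X' Y' where "X' = root z *v X" and "Y' = root z *v Y"
  have li: "lin_indep2 X' Y'"
    using lin_indep2_image[OF root_inv_mult_root[OF unit_interval[OF z]] XY] by (simp add: X'_def Y'_def)
  obtain a b d where orthonormal: "norm (a *\<^sub>R X') = 1" "norm (b *\<^sub>R Y' + d *\<^sub>R X') = 1"
      "(a *\<^sub>R X') \<bullet> (b *\<^sub>R Y' + d *\<^sub>R X') = 0" and scale: "(a * b)\<^sup>2 * gram X' Y' = 1"
    using gram_schmidt_pair[OF li] by blast
  have "weyl k z X' Y' / gram X' Y' = weyl k z (a *\<^sub>R X') (b *\<^sub>R Y' + d *\<^sub>R X')"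
    unfolding weyl_change_of_basis using scale gram_pos[OF li] by (simp add: field_simps)
  moreover have "(lam - 1) * weyl k z (a *\<^sub>R X') (b *\<^sub>R Y' + d *\<^sub>R X') \<le> 1"
    using z orthonormal by (intro assms) (simp add: frames_def)
  ultimately show "sec_curv metric z X Y \<le> 0"
    by (simp add: sec_curv_metric[OF z XY] X'_def Y'_def)
qed

lemma sec_curv_metric_frame:
  assumes frame: "(z, X, Y) \<in> frames" and z: "z \<in> ball 0 1"
  shows "\<exists>X' Y'. lin_indep2 X' Y' \<and> sec_curv metric z X' Y' = - 1 + (lam - 1) * weyl k z X Y"
proof -
  note t = unit_interval[OF z]
  have li: "lin_indep2 (root_inv z *v X) (root_inv z *v Y)"
    using lin_indep2_image[OF root_mult_root_inv[OF t] frames_lin_indep2[OF frame]] .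
  moreover have "sec_curv metric z (root_inv z *v X) (root_inv z *v Y) = - 1 + (lam - 1) * weyl k z X Y"
    by (simp add: sec_curv_metric[OF z li] root_root_inv[OF t] frames_gram[OF frame])
  ultimately show ?thesis by blast
qed

end

section \<open>The curvature threshold\<close>

definition flat_somewhere :: "('m::finite) mfield \<Rightarrow> bool" where
  "flat_somewhere g \<longleftrightarrow> (\<exists>p\<in>ball 0 1. \<exists>X Y. lin_indep2 X Y \<and> sec_curv g p X Y = 0)"

definition positively_curved_somewhere :: "('m::finite) mfield \<Rightarrow> bool" where
  "positively_curved_somewhere g \<longleftrightarrow> (\<exists>p\<in>ball 0 1. \<exists>X Y. lin_indep2 X Y \<and> sec_curv g p X Y > 0)"

definition curvature_alternative :: "real^('m::finite)^'m \<Rightarrow> (real \<Rightarrow> real) \<Rightarrow> real \<Rightarrow> bool" where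
  "curvature_alternative J lam R \<longleftrightarrow>
     (\<forall>r\<in>{0..<R}. \<exists>g. CCE_with_infinity J (lam r) g \<and> nonpos_curved g)
   \<or> (\<exists>r1\<in>{0..<R}. \<exists>G. (\<forall>r\<in>{0..r1}. CCE_with_infinity J (lam r) (G r) \<and> nonpos_curved (G r))
        \<and> flat_somewhere (G r1)
        \<and> (\<forall>\<epsilon>>0. \<exists>r2\<in>{r1<..<r1 + \<epsilon>}. \<exists>g. CCE_with_infinity J (lam r2) g \<and> positively_curved_somewhere g))"

lemma curvature_alternativeI:
  assumes R: "R > 0"
    and CCE: "\<And>r. r \<in> {0..R} \<Longrightarrow> CCE_with_infinity J (lam r) (G r)"
    and nonpos: "\<And>r. r \<in> {0..R} \<Longrightarrow> r * M \<le> 1 \<Longrightarrow> nonpos_curved (G r)"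
    and extremal: "\<And>r. M > 0 \<Longrightarrow> r \<in> {0..R} \<Longrightarrow>
      \<exists>p\<in>ball 0 1. \<exists>X Y. lin_indep2 X Y \<and> sec_curv (G r) p X Y = - 1 + r * M"
  shows "curvature_alternative J lam R"
proof (cases "R * M \<le> 1")
  case True
  have "r * M \<le> 1" if "r \<in> {0..<R}" for r
  proof (cases "M \<ge> 0")
    case True
    then show ?thesis using that \<open>R * M \<le> 1\<close> mult_right_mono[of r R M] by auto
  next
    case False
    then have "r * M \<le> 0" using that by (intro mult_nonneg_nonpos) auto
    then show ?thesis by simp
  qed
  then have "\<forall>r\<in>{0..<R}. \<exists>g. CCE_with_infinity J (lam r) g \<and> nonpos_curved g"
    using CCE nonpos by (meson atLeastLessThan_iff atLeastAtMost_iff less_imp_le)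
  then show ?thesis unfolding curvature_alternative_def by blast
next
  case False
  have M: "M > 0" using False R by (metis mult_nonneg_nonpos not_le less_imp_le order_trans zero_le_one)
  define r1 where "r1 = 1 / M"
  have r1: "r1 \<in> {0..<R}" "r1 * M = 1" using False M by (auto simp: r1_def field_simps)
  have "CCE_with_infinity J (lam r) (G r) \<and> nonpos_curved (G r)" if "r \<in> {0..r1}" for r
    using that r1 M mult_right_mono[of r r1 M] CCE[of r] nonpos[of r] by auto
  moreover have "flat_somewhere (G r1)"
    using extremal[OF M, of r1] r1 by (simp add: flat_somewhere_def)
  moreover have "\<exists>r2\<in>{r1<..<r1 + \<epsilon>}. \<exists>g. CCE_with_infinity J (lam r2) g \<and> positively_curved_somewhere g"
    if "\<epsilon> > 0" for \<epsilon>
  proof -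
    define r2 where "r2 = min (r1 + \<epsilon> / 2) R"
    have r2: "r2 \<in> {r1<..<r1 + \<epsilon>}" "r2 \<in> {0..R}" using that r1(1) by (auto simp: r2_def)
    then have "- 1 + r2 * M > 0" using mult_strict_right_mono[of r1 r2 M] M r1(2) by simp
    then have "positively_curved_somewhere (G r2)"
      using extremal[OF M r2(2)] unfolding positively_curved_somewhere_def by metis
    then show ?thesis using r2 CCE[OF r2(2)] by blast
  qed
  ultimately show ?thesis unfolding curvature_alternative_def using r1(1) by blast
qed

theorem (in complex_structure) taub_nut_alternative:
  assumes card: "CARD('m) = 2 * k + 2" and R: "R > 0"
    and pos: "\<And>r. r \<in> {0..R} \<Longrightarrow> 1 + s * r > 0"
  shows "curvature_alternative J (\<lambda>r. 1 + s * r) R"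
proof -
  obtain z0 X0 Y0 where frame: "(z0, X0, Y0) \<in> frames"
    and max: "\<And>z X Y. (z, X, Y) \<in> frames \<Longrightarrow> s * weyl k z X Y \<le> s * weyl k z0 X0 Y0"
    using weyl_attains_max[where s = s] by metis
  let ?M = "s * weyl k z0 X0 Y0"
  have taub_nut: "taub_nut J k (1 + s * r)" if "r \<in> {0..R}" for r
    using card pos[OF that] by unfold_locales
  show ?thesis
  proof (rule curvature_alternativeI[where G = "\<lambda>r. taub_nut.metric J k (1 + s * r)" and M = ?M, OF R])
    fix r assume r: "r \<in> {0..R}"
    interpret taub_nut J k "1 + s * r" by (rule taub_nut[OF r])
    show "CCE_with_infinity J (1 + s * r) metric" by (rule CCE_metric)
    show "nonpos_curved metric" if "r * ?M \<le> 1"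
    proof (rule nonpos_curved_metric)
      fix z X Y :: "real^'m" assume "(z, X, Y) \<in> frames"
      then have "r * (s * weyl k z X Y) \<le> r * ?M" using r by (intro mult_left_mono max) auto
      then show "(1 + s * r - 1) * weyl k z X Y \<le> 1" using that by (simp add: mult_ac)
    qed
    show "\<exists>p\<in>ball 0 1. \<exists>X Y. lin_indep2 X Y \<and> sec_curv metric p X Y = - 1 + r * ?M" if "?M > 0"
    proof -
      have "norm z0 \<noteq> 1" using that weyl_sphere[of z0 k X0 Y0] by auto
      then have z0: "z0 \<in> ball 0 1" using frame by (auto simp: frames_def)
      have "(1 + s * r - 1) * weyl k z0 X0 Y0 = r * ?M" by simp
      then show ?thesis using sec_curv_metric_frame[OF frame z0] z0 by metis
    qed
  qed
qed

lemma curvature_alternative_reparametrize: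
  assumes "curvature_alternative J lam R"
    and inverse: "\<And>l. lam (par l) = l" "\<And>r. par (lam r) = r"
    and I: "\<And>l. l \<in> I \<Longrightarrow> par l \<in> {0..<R}" "\<And>r. r \<in> {0..<R} \<Longrightarrow> lam r \<in> I"
    and near: "\<And>r l. l \<in> near (lam r) \<Longrightarrow> par l \<in> {0..r}"
    and beyond: "\<And>r r' \<epsilon>. r' \<in> {r<..<r + \<epsilon>} \<Longrightarrow> lam r' \<in> beyond (lam r) \<epsilon>"
  shows "(\<forall>l\<in>I. \<exists>g. CCE_with_infinity J l g \<and> nonpos_curved g)
    \<or> (\<exists>l1\<in>I. \<exists>G. (\<forall>l\<in>near l1. CCE_with_infinity J l (G l) \<and> nonpos_curved (G l)) \<and> flat_somewhere (G l1)
        \<and> (\<forall>\<epsilon>>0. \<exists>l2\<in>beyond l1 \<epsilon>. \<exists>g. CCE_with_infinity J l2 g \<and> positively_curved_somewhere g))"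
  using assms(1) unfolding curvature_alternative_def
proof (elim disjE bexE exE conjE)
  assume "\<forall>r\<in>{0..<R}. \<exists>g. CCE_with_infinity J (lam r) g \<and> nonpos_curved g"
  then show ?thesis using I(1) inverse(1) by metis
next
  fix r1 G
  assume r1: "r1 \<in> {0..<R}" and G: "\<forall>r\<in>{0..r1}. CCE_with_infinity J (lam r) (G r) \<and> nonpos_curved (G r)"
    "flat_somewhere (G r1)"
    "\<forall>\<epsilon>>0. \<exists>r2\<in>{r1<..<r1 + \<epsilon>}. \<exists>g. CCE_with_infinity J (lam r2) g \<and> positively_curved_somewhere g"
  have "\<forall>l\<in>near (lam r1). CCE_with_infinity J l (G (par l)) \<and> nonpos_curved (G (par l))"
    using G(1) near inverse(1) by metis
  moreover have "flat_somewhere (G (par (lam r1)))" using G(2) by (simp add: inverse(2))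
  moreover have "\<forall>\<epsilon>>0. \<exists>l2\<in>beyond (lam r1) \<epsilon>. \<exists>g. CCE_with_infinity J l2 g \<and> positively_curved_somewhere g"
    using G(3) beyond by metis
  ultimately show ?thesis
    using I(2)[OF r1] by (intro disjI2 bexI[of _ "lam r1"] exI[of _ "\<lambda>l. G (par l)"] conjI)
qed

theorem theorem1p4:
  fixes J :: "real^'m^'m" and k :: nat
  assumes "k \<ge> 1" and "CARD('m) = 2 * k + 2"
    and "J ** J = - mat 1" and "transpose J ** J = mat 1"
  shows
   "((\<forall>lam\<in>{1 / (real (2*k+1) + 1)<..1}. \<exists>g. CCE_with_infinity J lam g \<and> nonpos_curved g)
     \<or> (\<exists>lam1\<in>{1 / (real (2*k+1) + 1)<..1}. \<exists>G.
          (\<forall>lam\<in>{lam1..1}. CCE_with_infinity J lam (G lam) \<and> nonpos_curved (G lam))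
        \<and> (\<exists>p\<in>ball 0 1. \<exists>X Y. lin_indep2 X Y \<and> sec_curv (G lam1) p X Y = 0)
        \<and> (\<forall>\<epsilon>>0. \<exists>lam2\<in>{lam1 - \<epsilon><..<lam1}. \<exists>g. CCE_with_infinity J lam2 g \<and>
              (\<exists>p\<in>ball 0 1. \<exists>X Y. lin_indep2 X Y \<and> sec_curv g p X Y > 0))))
  \<and> ((\<forall>lam\<in>{1..<real (2*k+1) + 1}. \<exists>g. CCE_with_infinity J lam g \<and> nonpos_curved g)
     \<or> (\<exists>lam1\<in>{1..<real (2*k+1) + 1}. \<exists>G.
          (\<forall>lam\<in>{1..lam1}. CCE_with_infinity J lam (G lam) \<and> nonpos_curved (G lam))
        \<and> (\<exists>p\<in>ball 0 1. \<exists>X Y. lin_indep2 X Y \<and> sec_curv (G lam1) p X Y = 0)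
        \<and> (\<forall>\<epsilon>>0. \<exists>lam2\<in>{lam1<..<lam1 + \<epsilon>}. \<exists>g. CCE_with_infinity J lam2 g \<and>
              (\<exists>p\<in>ball 0 1. \<exists>X Y. lin_indep2 X Y \<and> sec_curv g p X Y > 0))))"
proof -
  interpret complex_structure J using assms(3,4) by unfold_locales
  define N where "N = real (2*k+1) + 1"
  have N: "1 / N > 0" "1 / N < 1" "N > 1" by (simp_all add: N_def)
  have "1 + - 1 * r > 0" if "r \<in> {0..1 - 1 / N}" for r using that N(1) unfolding atLeastAtMost_iff by linarith
  then have below: "curvature_alternative J ((-) 1) (1 - 1 / N)"
    using taub_nut_alternative[OF assms(2), of "1 - 1 / N" "- 1"] N by simp
  have above: "curvature_alternative J ((+) 1) (N - 1)"
    using taub_nut_alternative[OF assms(2), of "N - 1" 1] N by simp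
  show ?thesis
    unfolding N_def[symmetric] flat_somewhere_def[symmetric] positively_curved_somewhere_def[symmetric]
    by (intro conjI curvature_alternative_reparametrize[OF below, where par = "(-) 1"]
        curvature_alternative_reparametrize[OF above, where par = "\<lambda>lam. lam - 1"]) auto
qed

end
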